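(* Let $\mathcal R'$ be a partial Helly circular-arc representation of a graph $G$ whose arcs have pairwise distinct endpoints, suppose $\mathrm{Reg}(C)\neq\emptyset$ for every maximal clique $C$ of $G$, and let $D$ be a maximal clique of $G$. There exists a Helly circular-arc representation of $G$ extending $\mathcal R'$ if and only if for some point $p_D\in\mathrm{Reg}(D)$, with the corresponding partial order $\prec$ (defined in the context), there exists a linear extension $<$ of $\prec$ such that: (1) for every vertex $v$, the set $M_v$ of maximal cliques containing $v$ is consecutive in $[<]$; (2) for every gap $J$ of a maximal clique $C$, the set $S_J$ is consecutive in $[<]$.
   Context: Circular-arc representations assign closed arcs $R(v)$ of a fixed circle to vertices with $R(u)\cap R(v)\neq\emptyset$ iff $uv\in E(G)$; Helly means every family of pairwise intersecting arcs has a common point. A partial representation $\mathcal R'$ is a (Helly) representation of an induced subgraph $G'$ of $G$; $\mathcal R$ extends it if $R(u)=R'(u)$ for all $u\in V(G')$. For a maximal clique $C$: $\mathrm{Pre}(C)=\{R'(v): v\in C\cap V(G')\}$, $\mathrm{Reg}^+(C)=\bigcap_{R\in\mathrm{Pre}(C)}R$, $\mathrm{Reg}^-(C)=\bigcup_{R\in\mathcal R'\setminus\mathrm{Pre}(C)}R$, $\mathrm{Reg}(C)=\mathrm{Reg}^+(C)\setminus\mathrm{Reg}^-(C)$. Gaps of $C$ are the connected components of the complement of $\mathrm{Reg}(C)$; for a gap $J$, $S_J=\{C: \mathrm{Reg}(C)\cap J\neq\emptyset\}$. Given $p_D$, let $\le$ be the linear order of circle points obtained by traversing clockwise from $p_D$;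 $\prec$ is the partial order on maximal cliques with $D\prec C$ for all $C\neq D$ and, for $C,C'\neq D$, $C\prec C'$ whenever $p<q$ for all $p\in\mathrm{Reg}(C)$, $q\in\mathrm{Reg}(C')$. $[<]$ is the cyclic order induced by a linear order $<$; consecutive means forming a contiguous block cyclically. *)

theory Defs
  imports "HOL-Analysis.Analysis"
begin

text \<open>A graph is a vertex set together with its adjacency relation.\<close>

definition simple_graph :: "'a set \<Rightarrow> ('a \<times> 'a) set \<Rightarrow> bool" where
  "simple_graph V E \<longleftrightarrow> finite V \<and> E \<subseteq> V \<times> V \<and> sym E \<and> irrefl E"

definition induced_edges :: "('a \<times> 'a) set \<Rightarrow> 'a set \<Rightarrow> ('a \<times> 'a) set" where
  "induced_edges E W = E \<inter> W \<times> W"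

definition is_clique :: "'a set \<Rightarrow> ('a \<times> 'a) set \<Rightarrow> 'a set \<Rightarrow> bool" where
  "is_clique V E C \<longleftrightarrow> C \<subseteq> V \<and> (\<forall>u\<in>C. \<forall>v\<in>C. u \<noteq> v \<longrightarrow> (u, v) \<in> E)"

definition max_cliques :: "'a set \<Rightarrow> ('a \<times> 'a) set \<Rightarrow> 'a set set" where
  "max_cliques V E = {C. is_clique V E C \<and> (\<forall>C'. is_clique V E C' \<and> C \<subseteq> C' \<longrightarrow> C' = C)}"

definition circle :: "complex set" where
  "circle = sphere 0 1"

text \<open>Arcs have two distinct endpoints, so neither single points nor the whole circle are arcs.
  Since the parameters \<open>a < b < a + 2 * pi\<close> of an arc are determined by the arc up to a common
  multiple of \<open>2 * pi\<close>, \<open>endpoints\<close> of an arc has exactly two elements.\<close>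

definition closed_arc :: "complex set \<Rightarrow> bool" where
  "closed_arc A \<longleftrightarrow> (\<exists>a b. a < b \<and> b < a + 2 * pi \<and> A = cis ` {a..b})"

definition endpoints :: "complex set \<Rightarrow> complex set" where
  "endpoints A = {p. \<exists>a b. a < b \<and> b < a + 2 * pi \<and> A = cis ` {a..b} \<and> (p = cis a \<or> p = cis b)}"

definition circular_arc_rep ::
  "'a set \<Rightarrow> ('a \<times> 'a) set \<Rightarrow> ('a \<Rightarrow> complex set) \<Rightarrow> bool" where
  "circular_arc_rep V E R \<longleftrightarrow>
     (\<forall>v\<in>V. closed_arc (R v)) \<and>
     (\<forall>u\<in>V. \<forall>v\<in>V. u \<noteq> v \<longrightarrow> (R u \<inter> R v \<noteq> {} \<longleftrightarrow> (u, v) \<in> E))"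

definition helly_rep :: "'a set \<Rightarrow> ('a \<times> 'a) set \<Rightarrow> ('a \<Rightarrow> complex set) \<Rightarrow> bool" where
  "helly_rep V E R \<longleftrightarrow> circular_arc_rep V E R \<and>
     (\<forall>F \<subseteq> R ` V. (\<forall>A\<in>F. \<forall>B\<in>F. A \<inter> B \<noteq> {}) \<longrightarrow> (\<exists>p\<in>circle. \<forall>A\<in>F. p \<in> A))"

text \<open>A partial representation is given by the vertex set \<open>W\<close> of the induced subgraph and the
  map \<open>R'\<close>, whose values outside \<open>W\<close> are irrelevant.\<close>

definition partial_helly_rep ::
  "'a set \<Rightarrow> ('a \<times> 'a) set \<Rightarrow> 'a set \<Rightarrow> ('a \<Rightarrow> complex set) \<Rightarrow> bool" where
  "partial_helly_rep V E W R' \<longleftrightarrow> W \<subseteq> V \<and> helly_rep W (induced_edges E W) R'"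

definition distinct_endpoints :: "'a set \<Rightarrow> ('a \<Rightarrow> complex set) \<Rightarrow> bool" where
  "distinct_endpoints W R' \<longleftrightarrow> disjoint_family_on (\<lambda>v. endpoints (R' v)) W"

definition rep_extends :: "'a set \<Rightarrow> ('a \<Rightarrow> complex set) \<Rightarrow> ('a \<Rightarrow> complex set) \<Rightarrow> bool" where
  "rep_extends W R' R \<longleftrightarrow> (\<forall>u\<in>W. R u = R' u)"

definition Pre :: "'a set \<Rightarrow> ('a \<Rightarrow> complex set) \<Rightarrow> 'a set \<Rightarrow> complex set set" where
  "Pre W R' C = R' ` (C \<inter> W)"

text \<open>The intersection with \<open>circle\<close> makes the intersection of no arcs the whole circle.\<close>

definition Reg_plus :: "'a set \<Rightarrow> ('a \<Rightarrow> complex set) \<Rightarrow> 'a set \<Rightarrow> complex set" where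
  "Reg_plus W R' C = circle \<inter> \<Inter> (Pre W R' C)"

definition Reg_minus :: "'a set \<Rightarrow> ('a \<Rightarrow> complex set) \<Rightarrow> 'a set \<Rightarrow> complex set" where
  "Reg_minus W R' C = \<Union> (R' ` W - Pre W R' C)"

definition Reg :: "'a set \<Rightarrow> ('a \<Rightarrow> complex set) \<Rightarrow> 'a set \<Rightarrow> complex set" where
  "Reg W R' C = Reg_plus W R' C - Reg_minus W R' C"

definition gaps :: "'a set \<Rightarrow> ('a \<Rightarrow> complex set) \<Rightarrow> 'a set \<Rightarrow> complex set set" where
  "gaps W R' C = components (circle - Reg W R' C)"

definition gap_cliques ::
  "'a set \<Rightarrow> ('a \<times> 'a) set \<Rightarrow> 'a set \<Rightarrow> ('a \<Rightarrow> complex set) \<Rightarrow> complex set \<Rightarrow> 'a set set" where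
  "gap_cliques V E W R' J = {C \<in> max_cliques V E. Reg W R' C \<inter> J \<noteq> {}}"

definition vertex_cliques :: "'a set \<Rightarrow> ('a \<times> 'a) set \<Rightarrow> 'a \<Rightarrow> 'a set set" where
  "vertex_cliques V E v = {C \<in> max_cliques V E. v \<in> C}"

text \<open>For points \<open>s\<close>, \<open>p\<close> of the circle, \<open>Arg2pi (s / p)\<close> in \<open>[0, 2 * pi)\<close> is the angle swept when
  moving clockwise from \<open>s\<close> to \<open>p\<close>.\<close>

definition clockwise_less :: "complex \<Rightarrow> complex \<Rightarrow> complex \<Rightarrow> bool" where
  "clockwise_less s p q \<longleftrightarrow> Arg2pi (s / p) < Arg2pi (s / q)"

definition clique_prec ::
  "'a set \<Rightarrow> ('a \<times> 'a) set \<Rightarrow> 'a set \<Rightarrow> ('a \<Rightarrow> complex set) \<Rightarrow> 'a set \<Rightarrow> complex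
     \<Rightarrow> ('a set \<times> 'a set) set" where
  "clique_prec V E W R' D pD =
     {(C, C'). C \<in> max_cliques V E \<and> C' \<in> max_cliques V E \<and> C' \<noteq> D \<and>
        (C = D \<or> (\<forall>p\<in>Reg W R' C. \<forall>q\<in>Reg W R' C'. clockwise_less pD p q))}"

definition linear_extension :: "'b set \<Rightarrow> ('b \<times> 'b) set \<Rightarrow> ('b \<times> 'b) set \<Rightarrow> bool" where
  "linear_extension X P L \<longleftrightarrow> L \<subseteq> X \<times> X \<and> strict_linear_order_on X L \<and> P \<subseteq> L"

definition cyclic_order :: "('b \<times> 'b) set \<Rightarrow> ('b \<times> 'b \<times> 'b) set" where
  "cyclic_order L =
     {(x, y, z). (x, y) \<in> L \<and> (y, z) \<in> L \<or> (y, z) \<in> L \<and> (z, x) \<in> L \<or> (z, x) \<in> L \<and> (x, y) \<in> L}"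

text \<open>A nonempty consecutive set is a cyclic interval, running from some first element \<open>a\<close> to some
  last element \<open>b\<close>.\<close>

definition consecutive :: "'b set \<Rightarrow> ('b \<times> 'b \<times> 'b) set \<Rightarrow> 'b set \<Rightarrow> bool" where
  "consecutive X cyc S \<longleftrightarrow>
     S = {} \<or> (\<exists>a\<in>S. \<exists>b\<in>S. S = {x \<in> X. x = a \<or> x = b \<or> (a, x, b) \<in> cyc})"

end

(*
  A Helly representation gives every maximal clique C a point of Reg(C) that lies exactly in the
  arcs of the vertices of C; the clockwise order of these points, cut at the point of D, is the
  required order. Two regions never alternate around the circle, because an arc separating them
  would be disconnected. Hence Reg(C') lies in a single gap J of C, so S_J consists of the cliques
  whose points lie in the connected set J.

  Conversely, the endpoints of the given arcs cut the circle, opened inside Reg(D), into finitely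
  many cells. Following the linear order, put each clique greedily into the first cell of its
  region that is not before the previous one. If this fails at C', with C the first clique placed
  beyond all cells of C', then either Reg(C') precedes Reg(C), contradicting the linear extension,
  or some gap J of C contains the regions of C' and of the predecessor of C; since S_J avoids C and
  D, it is not consecutive. Spreading the cliques inside the cells gives distinct points, and every
  new vertex v gets the arc from the first to the last point of M_v.
*)

theory Submission imports Defs begin

text \<open>A region depends on its clique \<open>C\<close> only through C \<inter> W, so several
  cliques may share one region, and a region may have several components. The partial order compares
  two cliques other than \<open>D\<close> only if one region lies wholly before the other;
  interleaved regions are what the gap condition controls. Placing cliques in cells before choosing
  points lets cliques that share a cell be spread apart in the prescribed order. This needs room: if
  two arcs could touch in a common end, a region might be a single point, whereas distinct endpoints
  give every point of a region further points of it on one side. The given point of the region of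
  \<open>D\<close> may still be an end of that region. The cut is then moved to a nearby interior
  point; only points of the region of \<open>D\<close> are passed over, so comparisons between
  points outside it survive.\<close>

section \<open>Points and arcs of the circle\<close>

text \<open>The point reached from \<open>cis \<beta>\<close> by moving clockwise through the angle \<open>t\<close>.\<close>

definition cw :: "real \<Rightarrow> real \<Rightarrow> complex" where
  "cw \<beta> t = cis (\<beta> - t)"

lemma cw_in_circle [simp]: "cw \<beta> t \<in> circle"
  by (simp add: cw_def circle_def)

lemma cw_add: "cw (\<beta> - h) t = cw \<beta> (t + h)"
  by (simp add: cw_def algebra_simps)

lemma cw_periodic [simp]: "cw \<beta> (t + 2 * pi) = cw \<beta> t"
  by (simp add: cw_def complex_eq_iff cos_diff sin_diff)

lemma continuous_on_cw [continuous_intros]: "continuous_on S (cw \<beta>)"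
  unfolding cw_def by (intro continuous_intros)

lemma cw_eq_iff: "cw \<beta> x = cw \<beta> y \<longleftrightarrow> (\<exists>n::int. x = y + 2 * pi * n)"
proof -
  have "cw \<beta> x = cw \<beta> y \<longleftrightarrow> (\<exists>n::int. \<beta> - y = \<beta> - x + 2 * pi * n)"
    unfolding sin_cos_eq_iff [symmetric] cw_def complex_eq_iff by auto
  also have "\<dots> \<longleftrightarrow> (\<exists>n::int. x = y + 2 * pi * n)"
    by (simp add: algebra_simps eq_commute)
  finally show ?thesis .
qed

lemma cw_eq_cases:
  assumes "cw \<beta> x = cw \<beta> y" "x \<le> y" "y \<le> x + 2 * pi"
  shows "x = y \<or> y = x + 2 * pi"
proof -
  obtain n :: int where n: "y = x + 2 * pi * n"
    using assms(1) cw_eq_iff by metis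
  have "real_of_int n \<ge> 0" "real_of_int n \<le> 1"
    using assms(2,3) n pi_gt_zero by (auto simp: zero_le_mult_iff)
  then have "n = 0 \<or> n = 1" by linarith
  then show ?thesis using n by auto
qed

lemma cw_inj:
  assumes "cw \<beta> x = cw \<beta> y" "\<bar>x - y\<bar> < 2 * pi"
  shows "x = y"
  using cw_eq_cases [of \<beta> x y] cw_eq_cases [of \<beta> y x] assms by (cases "x \<le> y") auto

lemma circle_cwE:
  assumes "p \<in> circle"
  obtains t where "s \<le> t" "t < s + 2 * pi" "p = cw \<beta> t"
proof -
  have "p = cis (Arg p)"
    using assms rcis_cmod_Arg [of p] by (simp add: circle_def rcis_def)
  then have p: "p = cw \<beta> (\<beta> - Arg p)" by (simp add: cw_def)
  define n where "n = \<lfloor>(\<beta> - Arg p - s) / (2 * pi)\<rfloor>"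
  define t where "t = \<beta> - Arg p + 2 * pi * of_int (- n)"
  have "of_int n \<le> (\<beta> - Arg p - s) / (2 * pi)" "(\<beta> - Arg p - s) / (2 * pi) < of_int n + 1"
    unfolding n_def by linarith+
  then have "s \<le> t" "t < s + 2 * pi"
    unfolding t_def by (simp_all add: field_simps)
  moreover have "p = cw \<beta> t"
    using p cw_eq_iff [of \<beta> t "\<beta> - Arg p"] t_def by metis
  ultimately show thesis using that by blast
qed

text \<open>The quotient \<open>cw \<beta> 0 / cw \<beta> x\<close> is \<open>cis x\<close>, whose
  angle in [0, 2 * pi) is \<open>x\<close> itself.\<close>

lemma clockwise_less_cw:
  assumes "0 \<le> x" "x < 2 * pi" "0 \<le> y" "y < 2 * pi"
  shows "clockwise_less (cw \<beta> 0) (cw \<beta> x) (cw \<beta> y) \<longleftrightarrow> x < y"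
proof -
  have "Arg2pi (cis t) = t" if "0 \<le> t" "t < 2 * pi" for t
    using Arg2pi_unique [of 1 t "cis t"] that by (simp add: cis_conv_exp)
  then show ?thesis using assms by (simp add: clockwise_less_def cw_def cis_divide)
qed

text \<open>The angles \<open>s\<close> and \<open>t\<close> split the circle into two closed arcs
  that meet only in the excluded points. A connected set avoiding these points lies in one of the
  arcs, and \<open>u\<close> decides which.\<close>

lemma connected_subset_cw_interval:
  assumes Z: "connected Z" "Z \<subseteq> circle"
    and ends: "cw \<beta> s \<notin> Z" "cw \<beta> t \<notin> Z"
    and st: "s < t" "t < s + 2 * pi"
    and u: "cw \<beta> u \<in> Z" "s < u" "u < t"
  shows "Z \<subseteq> cw \<beta> ` {s<..<t}"
proof (rule ccontr)
  assume "\<not> Z \<subseteq> cw \<beta> ` {s<..<t}"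
  then obtain z where z: "z \<in> Z" "z \<notin> cw \<beta> ` {s<..<t}" by blast
  have cover: "p \<in> cw \<beta> ` {s..t} \<or> p \<in> cw \<beta> ` {t..s + 2 * pi}" if p: "p \<in> Z" for p
  proof -
    obtain x where "s \<le> x" "x < s + 2 * pi" "p = cw \<beta> x"
      using circle_cwE [of p s \<beta>] p Z(2) by blast
    then show ?thesis by (cases "x \<le> t") auto
  qed
  have "cw \<beta> x \<notin> Z" if "s \<le> x" "x \<le> t" "t \<le> y" "y \<le> s + 2 * pi" "cw \<beta> x = cw \<beta> y" for x y
  proof -
    have "x = y \<or> y = x + 2 * pi" using cw_eq_cases [of \<beta> x y] that by linarith
    then have "x = t \<or> x = s" using that by linarith
    then show ?thesis using ends by blast
  qed
  then have disj: "cw \<beta> ` {s..t} \<inter> cw \<beta> ` {t..s + 2 * pi} \<inter> Z = {}"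
    by (auto simp only: disjoint_iff elim!: IntE imageE) (simp only: atLeastAtMost_iff, blast)
  have "z \<in> cw \<beta> ` {t..s + 2 * pi}"
  proof -
    have "z \<notin> cw \<beta> ` {s..t}"
    proof
      assume "z \<in> cw \<beta> ` {s..t}"
      then obtain x where x: "s \<le> x" "x \<le> t" "z = cw \<beta> x" by auto
      then have "x \<noteq> s" "x \<noteq> t" using z(1) ends by blast+
      then show False using z(2) x by simp
    qed
    then show ?thesis using cover z(1) by blast
  qed
  moreover have "cw \<beta> u \<in> cw \<beta> ` {s..t}" using u by simp
  moreover have "closed (cw \<beta> ` {s..t})" "closed (cw \<beta> ` {t..s + 2 * pi})"
    by (intro compact_imp_closed compact_continuous_image continuous_on_cw compact_Icc)+
  moreover have "Z \<subseteq> cw \<beta> ` {s..t} \<union> cw \<beta> ` {t..s + 2 * pi}" using cover by blast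
  ultimately show False
    using connected_closedD [OF Z(1) disj] z(1) u(1) by blast
qed

text \<open>With the points at \<open>b\<close> and \<open>d\<close> excluded, \<open>c\<close>
  confines \<open>Z\<close> to the angles between them, where the point at \<open>a\<close> does not
  occur.\<close>

lemma connected_no_alternation:
  assumes "connected Z" "Z \<subseteq> circle"
    and "cw \<beta> a \<in> Z" "cw \<beta> b \<notin> Z" "cw \<beta> c \<in> Z" "cw \<beta> d \<notin> Z"
    and "a < b" "b < c" "c < d" "d < a + 2 * pi"
  shows False
proof -
  have "Z \<subseteq> cw \<beta> ` {b<..<d}"
    by (rule connected_subset_cw_interval [of _ _ _ _ c]) (use assms in auto)
  then have "cw \<beta> a \<in> cw \<beta> ` {b<..<d}" using assms(3) by blast
  then obtain x where "b < x" "x < d" "cw \<beta> a = cw \<beta> x" by (auto elim!: imageE)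
  then show False using cw_inj [of \<beta> a x] assms by auto
qed

section \<open>Closed arcs and their ends\<close>

lemma closed_arcE:
  assumes "closed_arc A"
  obtains a b where "a < b" "b < a + 2 * pi" "A = cw \<beta> ` {a..b}"
    "cw \<beta> a \<in> endpoints A" "cw \<beta> b \<in> endpoints A"
proof -
  obtain a b where ab: "a < b" "b < a + 2 * pi" "A = cis ` {a..b}"
    using assms unfolding closed_arc_def by blast
  \<comment> \<open>\<open>cw\<close> runs against the direction of \<open>cis\<close>, so the
    reflection exchanges the roles of \<open>a\<close> and \<open>b\<close>.\<close>
  have "{a..b} = (\<lambda>t. \<beta> - t) ` {\<beta> - b..\<beta> - a}" by simp
  then have "A = cw \<beta> ` {\<beta> - b..\<beta> - a}" 
    unfolding ab cw_def by (metis (no_types, lifting) image_cong image_image)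
  moreover have "cw \<beta> (\<beta> - b) \<in> endpoints A" "cw \<beta> (\<beta> - a) \<in> endpoints A"
    using ab unfolding endpoints_def cw_def by auto
  ultimately show thesis using that [of "\<beta> - b" "\<beta> - a"] ab by simp
qed

lemma closed_arc_cw:
  assumes "a < b" "b < a + 2 * pi"
  shows "closed_arc (cw \<beta> ` {a..b})"
proof -
  have "cw \<beta> ` {a..b} = cis ` (\<lambda>t. \<beta> - t) ` {a..b}" unfolding cw_def image_image ..
  also have "\<dots> = cis ` {\<beta> - b..\<beta> - a}" by simp
  finally show ?thesis unfolding closed_arc_def using assms
    by (intro exI [of _ "\<beta> - b"] exI [of _ "\<beta> - a"]) simp
qed

lemma closed_arc_connected: "closed_arc A \<Longrightarrow> connected A"
  by (erule closed_arcE [where \<beta> = 0])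
    (auto intro!: connected_continuous_image continuous_on_cw)

lemma closed_arc_subset_circle: "closed_arc A \<Longrightarrow> A \<subseteq> circle"
  by (erule closed_arcE [where \<beta> = 0]) auto

lemma closed_arc_nonempty: "closed_arc A \<Longrightarrow> A \<noteq> {}"
  by (erule closed_arcE [where \<beta> = 0]) auto

text \<open>The set \<open>e\<close> need not be identified with \<open>endpoints A\<close>, so the uniqueness of the
  parameters of an arc is never proved.\<close>

lemma closed_arc_ends:
  assumes "closed_arc A"
  shows "\<exists>e. finite e \<and> e \<noteq> {} \<and> e \<subseteq> endpoints A \<and>
    (\<forall>Z. connected Z \<longrightarrow> Z \<subseteq> circle \<longrightarrow> Z \<inter> e = {} \<longrightarrow> Z \<subseteq> A \<or> Z \<inter> A = {}) \<and>
    (\<forall>\<beta> u. cw \<beta> u \<in> e \<longrightarrow> cw \<beta> u \<in> A \<and>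
       ((\<forall>\<^sub>F x in at_right u. cw \<beta> x \<in> A) \<or> (\<forall>\<^sub>F x in at_left u. cw \<beta> x \<in> A)))"
proof -
  obtain a b where ab: "a < b" "b < a + 2 * pi" "A = cw 0 ` {a..b}"
    "cw 0 a \<in> endpoints A" "cw 0 b \<in> endpoints A"
    using closed_arcE [OF assms, where \<beta> = 0] .
  have "Z \<subseteq> A \<or> Z \<inter> A = {}" if Z: "connected Z" "Z \<subseteq> circle" "Z \<inter> {cw 0 a, cw 0 b} = {}" for Z
  proof (rule disjCI)
    assume "Z \<inter> A \<noteq> {}"
    then obtain x where x: "x \<in> {a..b}" "cw 0 x \<in> Z" using ab(3) by blast
    then have "x \<noteq> a" "x \<noteq> b" using Z(3) by blast+
    then have "Z \<subseteq> cw 0 ` {a<..<b}"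
      using connected_subset_cw_interval [OF Z(1,2), of 0 a b x] Z(3) x ab by auto
    also have "\<dots> \<subseteq> A" unfolding ab(3) by (intro image_mono) auto
    finally show "Z \<subseteq> A" .
  qed
  moreover have "cw \<beta> u \<in> A \<and>
       ((\<forall>\<^sub>F x in at_right u. cw \<beta> x \<in> A) \<or> (\<forall>\<^sub>F x in at_left u. cw \<beta> x \<in> A))"
    if "cw \<beta> u \<in> {cw 0 a, cw 0 b}" for \<beta> u
  proof -
    \<comment> \<open>Turning away from a common point by the same angle gives the same point in
      both parametrisations. One-sided neighbourhoods of \<open>u\<close> thus become those of the
      parameters \<open>a\<close> and \<open>b\<close>.\<close>
    have shift: "cw \<beta> x = cw 0 (x - u + c)" if "cw \<beta> u = cw 0 c" for x c
    proof -
      have "cw \<beta> x = cw \<beta> u * cis (u - x)" by (simp add: cw_def cis_mult)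
      also have "\<dots> = cw 0 (x - u + c)" by (simp add: that) (simp add: cw_def cis_mult algebra_simps)
      finally show ?thesis .
    qed
    show ?thesis
    proof (cases "cw \<beta> u = cw 0 a")
      case True
      have "\<forall>\<^sub>F x in at_right u. x \<in> {u<..<u + (b - a)}"
        using ab(1) by (intro eventually_at_right_real) simp
      then have "\<forall>\<^sub>F x in at_right u. cw \<beta> x \<in> A"
        by eventually_elim (use ab in \<open>auto simp: shift [OF True]\<close>)
      then show ?thesis using True ab by auto
    next
      case False
      then have *: "cw \<beta> u = cw 0 b" using that by auto
      have "\<forall>\<^sub>F x in at_left u. x \<in> {u - (b - a)<..<u}"
        using ab(1) by (intro eventually_at_left_real) simp
      then have "\<forall>\<^sub>F x in at_left u. cw \<beta> x \<in> A"
        by eventually_elim (use ab in \<open>auto simp: shift [OF *]\<close>)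
      then show ?thesis using * ab by auto
    qed
  qed
  ultimately show ?thesis using ab(4,5)
    by (intro exI [of _ "{cw 0 a, cw 0 b}"] conjI allI impI) (simp_all only: finite.intros insert_not_empty empty_subsetI insert_subset simp_thms)
qed

section \<open>Consecutive sets and greedy selection\<close>

text \<open>Reduces cyclic intervals to inequalities. The disjunct with \<open>f b < f a\<close> is
  the interval that wraps past the end of the linear order; injectivity turns the cases x = a and x
  = b into the boundary cases of \<le>.\<close>

lemma consecutive_iff_interval:
  fixes f :: "'b \<Rightarrow> 'c::linorder"
  assumes inj: "inj_on f X" and L: "L = {(x, y). x \<in> X \<and> y \<in> X \<and> f x < f y}" and S: "S \<subseteq> X"
  shows "consecutive X (cyclic_order L) S \<longleftrightarrow> S = {} \<or>
    (\<exists>a\<in>S. \<exists>b\<in>S. S = {x \<in> X. f a \<le> f x \<and> f x \<le> f b \<or> f b < f a \<and> (f x \<le> f b \<or> f a \<le> f x)})"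
proof -
  have "{x \<in> X. x = a \<or> x = b \<or> (a, x, b) \<in> cyclic_order L} =
      {x \<in> X. f a \<le> f x \<and> f x \<le> f b \<or> f b < f a \<and> (f x \<le> f b \<or> f a \<le> f x)}"
    if "a \<in> S" "b \<in> S" for a b
  proof (intro Collect_cong conj_cong refl)
    fix x assume "x \<in> X"
    then have "x = a \<longleftrightarrow> f x = f a" "x = b \<longleftrightarrow> f x = f b" "a \<in> X" "b \<in> X"
      using that S by (auto dest: inj_onD [OF inj])
    then show "(x = a \<or> x = b \<or> (a, x, b) \<in> cyclic_order L) \<longleftrightarrow>
        (f a \<le> f x \<and> f x \<le> f b \<or> f b < f a \<and> (f x \<le> f b \<or> f a \<le> f x))"
      using \<open>x \<in> X\<close> unfolding L cyclic_order_def by auto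
  qed
  then show ?thesis unfolding consecutive_def by (auto cong: bex_cong)
qed

lemma finite_minimizer:
  fixes f :: "'b \<Rightarrow> 'c::linorder"
  assumes "finite T" "T \<noteq> {}"
  shows "\<exists>m\<in>T. \<forall>x\<in>T. f m \<le> f x"
proof -
  have "Min (f ` T) \<in> f ` T" using assms by (intro Min_in) auto
  then obtain m where "m \<in> T" "f m = Min (f ` T)" by auto
  then show ?thesis using assms(1) by (intro bexI [of _ m]) auto
qed

lemma finite_maximizer:
  fixes f :: "'b \<Rightarrow> 'c::linorder"
  assumes "finite T" "T \<noteq> {}"
  shows "\<exists>m\<in>T. \<forall>x\<in>T. f x \<le> f m"
proof -
  have "Max (f ` T) \<in> f ` T" using assms by (intro Max_in) auto
  then obtain m where "m \<in> T" "f m = Max (f ` T)" by auto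
  then show ?thesis using assms(1) by (intro bexI [of _ m]) auto
qed

text \<open>If no outsider lies between the extreme elements of \<open>S\<close>, then
  \<open>S\<close> is an ordinary interval. Otherwise the outsiders themselves form one, from
  \<open>m\<close> to \<open>n\<close>, and \<open>S\<close> wraps around it.\<close>

lemma consecutive_if_no_alternation:
  fixes f :: "'b \<Rightarrow> 'c::linorder"
  assumes fin: "finite X" and inj: "inj_on f X"
    and L: "L = {(x, y). x \<in> X \<and> y \<in> X \<and> f x < f y}" and S: "S \<subseteq> X"
    and alt: "\<And>x x' y y'. x \<in> S \<Longrightarrow> x' \<in> S \<Longrightarrow> y \<in> X - S \<Longrightarrow> y' \<in> X - S \<Longrightarrow>
      \<not> (f x < f y \<and> f y < f x' \<and> f x' < f y') \<and> \<not> (f y < f x \<and> f x < f y' \<and> f y' < f x')"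
  shows "consecutive X (cyclic_order L) S"
proof (cases "S = {}")
  case True
  then show ?thesis by (simp add: consecutive_def)
next
  case False
  have finS: "finite S" using fin S finite_subset by blast
  have ne: "f x < f y \<or> f y < f x" if "x \<in> S" "y \<in> X - S" for x y
    using that S inj by (metis Diff_iff inj_onD neqE subsetD)
  obtain a where a: "a \<in> S" "\<And>x. x \<in> S \<Longrightarrow> f a \<le> f x" using finite_minimizer [OF finS False, of f] by blast
  obtain b where b: "b \<in> S" "\<And>x. x \<in> S \<Longrightarrow> f x \<le> f b" using finite_maximizer [OF finS False, of f] by blast
  show ?thesis
  proof (cases "\<exists>y\<in>X - S. f a < f y \<and> f y < f b")
    case False
    have "S = {x \<in> X. f a \<le> f x \<and> f x \<le> f b \<or> f b < f a \<and> (f x \<le> f b \<or> f a \<le> f x)}"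
    proof (intro set_eqI iffI)
      fix x assume x: "x \<in> {x \<in> X. f a \<le> f x \<and> f x \<le> f b \<or> f b < f a \<and> (f x \<le> f b \<or> f a \<le> f x)}"
      then have "f a \<le> f x" "f x \<le> f b" using a(2) [OF b(1)] by auto
      then show "x \<in> S" using False x ne [OF a(1), of x] ne [OF b(1), of x] by force
    qed (use S a b in auto)
    then show ?thesis unfolding consecutive_iff_interval [OF inj L S] using a b by blast
  next
    case True
    let ?Y = "X - S"
    from True have Y: "finite ?Y" "?Y \<noteq> {}" using fin by auto
    obtain m where m: "m \<in> ?Y" "\<And>y. y \<in> ?Y \<Longrightarrow> f m \<le> f y" using finite_minimizer [OF Y, of f] by blast
    obtain n where n: "n \<in> ?Y" "\<And>y. y \<in> ?Y \<Longrightarrow> f y \<le> f n" using finite_maximizer [OF Y, of f] by blast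
    obtain y where y: "y \<in> ?Y" "f a < f y" "f y < f b" using True by blast
    \<comment> \<open>An outsider \<open>m\<close> before \<open>a\<close> would produce the
      forbidden pattern \<open>m\<close>, \<open>a\<close>, \<open>y\<close>,
      \<open>b\<close>.\<close>
    have am: "f a < f m" using alt [OF a(1) b(1) m(1) y(1)] ne [OF a(1) m(1)] y by auto
    have nb: "f n < f b" using alt [OF a(1) b(1) y(1) n(1)] ne [OF b(1) n(1)] y by auto
    \<comment> \<open>The cyclic interval starts at the least element of \<open>S\<close> above
      \<open>n\<close> and ends at the greatest one below \<open>m\<close>.\<close>
    let ?B = "{x \<in> S. f x < f m}" and ?A = "{x \<in> S. f n < f x}"
    have "finite ?B" "?B \<noteq> {}" "finite ?A" "?A \<noteq> {}" using finS a(1) am b(1) nb by auto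
    then obtain a' b' where a': "a' \<in> ?A" "\<And>x. x \<in> ?A \<Longrightarrow> f a' \<le> f x"
      and b': "b' \<in> ?B" "\<And>x. x \<in> ?B \<Longrightarrow> f x \<le> f b'"
      using finite_maximizer [of ?B f] finite_minimizer [of ?A f] by meson
    have mn: "f m \<le> f n" using m n by blast
    have out: "f x < f m \<or> f n < f x" if "x \<in> S" for x
      using alt [OF a(1) that m(1) n(1)] ne [OF that m(1)] ne [OF that n(1)] am by auto
    have "S = {x \<in> X. f a' \<le> f x \<and> f x \<le> f b' \<or> f b' < f a' \<and> (f x \<le> f b' \<or> f a' \<le> f x)}"
    proof (intro set_eqI iffI)
      fix x assume "x \<in> S"
      then show "x \<in> {x \<in> X. f a' \<le> f x \<and> f x \<le> f b' \<or> f b' < f a' \<and> (f x \<le> f b' \<or> f a' \<le> f x)}"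
        using out [of x] a' b' mn S by auto
    next
      fix x assume x: "x \<in> {x \<in> X. f a' \<le> f x \<and> f x \<le> f b' \<or> f b' < f a' \<and> (f x \<le> f b' \<or> f a' \<le> f x)}"
      show "x \<in> S"
      proof (rule ccontr)
        assume "x \<notin> S"
        then have "f m \<le> f x" "f x \<le> f n" using x m n by auto
        then show False using x a'(1) b'(1) mn by auto
      qed
    qed
    then show ?thesis unfolding consecutive_iff_interval [OF inj L S] using a'(1) b'(1) by blast
  qed
qed

text \<open>Only the pattern that begins outside \<open>S\<close> is excluded: in the application
  \<open>y\<close> is the first clique \<open>D\<close>.\<close>

lemma consecutive_no_alternation:
  fixes f :: "'b \<Rightarrow> 'c::linorder"
  assumes inj: "inj_on f X" and L: "L = {(x, y). x \<in> X \<and> y \<in> X \<and> f x < f y}" and S: "S \<subseteq> X"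
    and con: "consecutive X (cyclic_order L) S"
    and alt: "x \<in> S" "x' \<in> S" "y \<in> X - S" "y' \<in> X - S" "f y < f x" "f x < f y'" "f y' < f x'"
  shows False
proof -
  obtain a b where ab: "S = {x \<in> X. f a \<le> f x \<and> f x \<le> f b \<or> f b < f a \<and> (f x \<le> f b \<or> f a \<le> f x)}"
    using con alt(1) unfolding consecutive_iff_interval [OF inj L S] by blast
  show False using alt unfolding ab by auto
qed

text \<open>The rank, the number of predecessors, serves twice: as the index along which the greedy
  choice runs and as the multiple by which clique points are spread.\<close>

lemma strict_linear_order_enumeration:
  assumes fin: "finite X" and L: "strict_linear_order_on X L" "L \<subseteq> X \<times> X"
  obtains r :: "'b \<Rightarrow> nat" where "bij_betw r X {..<card X}" "L = {(x, y). x \<in> X \<and> y \<in> X \<and> r x < r y}"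
proof -
  define r where "r x = card {y. (y, x) \<in> L}" for x
  have tr: "trans L" and irr: "irrefl L" and tot: "total_on X L"
    using L(1) unfolding strict_linear_order_on_def by auto
  have finr: "finite {y. (y, x) \<in> L}" for x
    using fin L(2) by (auto intro: finite_subset [of _ X])
  have mono: "r x < r y" if "(x, y) \<in> L" for x y
    unfolding r_def using that finr irr
    by (intro psubset_card_mono) (auto simp: irrefl_def dest: transD [OF tr])
  then have iff: "(x, y) \<in> L \<longleftrightarrow> r x < r y" if "x \<in> X" "y \<in> X" for x y
    using that tot unfolding total_on_def by (metis less_asym less_irrefl)
  have "r x < card X" if "x \<in> X" for x
    unfolding r_def using that fin L(2) irr by (intro psubset_card_mono) (auto simp: irrefl_def)
  moreover have inj: "inj_on r X"
    using iff tot unfolding inj_on_def total_on_def by (metis less_irrefl)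
  ultimately have "r ` X = {..<card X}"
    by (intro card_subset_eq) (auto simp: card_image)
  then have "bij_betw r X {..<card X}" using inj by (simp add: bij_betw_def)
  moreover have "L = {(x, y). x \<in> X \<and> y \<in> X \<and> r x < r y}" using iff L(2) by auto
  ultimately show thesis using that by blast
qed

text \<open>Greedy choice: \<open>c i\<close> is the least element of \<open>A i\<close> that is at least \<open>c (i - 1)\<close>.
  If there is none, let \<open>x\<close> be the maximum of \<open>A i\<close> and look at the first \<open>c j\<close> beyond \<open>x\<close>:
  either all of \<open>A j\<close> lies beyond \<open>A i\<close>, or \<open>A j\<close> jumps over both \<open>c (j - 1)\<close> and \<open>x\<close>.\<close>

lemma monotone_selection:
  fixes A :: "nat \<Rightarrow> nat set"
  assumes fin: "\<And>i. i < n \<Longrightarrow> finite (A i) \<and> A i \<noteq> {}"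
    and zero: "0 \<in> A 0"
    and not_beyond: "\<And>i j. 0 < i \<Longrightarrow> i < j \<Longrightarrow> j < n \<Longrightarrow> \<exists>x\<in>A i. \<exists>y\<in>A j. x \<le> y"
    and no_jump: "\<And>h j i a x y z. h < j \<Longrightarrow> j < i \<Longrightarrow> i < n \<Longrightarrow> a \<in> A h \<Longrightarrow> x \<in> A i \<Longrightarrow>
      y \<in> A j \<Longrightarrow> z \<in> A j \<Longrightarrow> y < a \<Longrightarrow> a \<le> x \<Longrightarrow> x < z \<Longrightarrow> \<exists>m\<in>A j. a \<le> m \<and> m \<le> x"
  shows "\<exists>c. (\<forall>i<n. c i \<in> A i) \<and> (\<forall>i j. i \<le> j \<longrightarrow> j < n \<longrightarrow> c i \<le> c j)"
proof -
  \<comment> \<open>Without a candidate the \<open>LEAST\<close> is unspecified; \<open>main\<close>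
    shows that this does not happen below \<open>n\<close>.\<close>
  define c where "c = rec_nat 0 (\<lambda>i p. LEAST m. m \<in> A (Suc i) \<and> p \<le> m)"
  have c0: "c 0 = 0" and cS: "c (Suc i) = (LEAST m. m \<in> A (Suc i) \<and> c i \<le> m)" for i
    by (simp_all add: c_def)
  have least: "c (Suc i) \<le> m" if "m \<in> A (Suc i)" "c i \<le> m" for i m
    unfolding cS using that by (intro Least_le) simp
  have main: "c i \<in> A i \<and> (\<forall>h. i = Suc h \<longrightarrow> c h \<le> c i)" if "i < n" for i
    using that
  proof (induction i rule: less_induct)
    case (less i)
    show ?case
    proof (cases i)
      case 0
      then show ?thesis using zero c0 by simp
    next
      case (Suc k)
      have "\<exists>m. m \<in> A i \<and> c k \<le> m"
      proof (rule ccontr)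
        assume none: "\<nexists>m. m \<in> A i \<and> c k \<le> m"
        define x where "x = Max (A i)"
        have x: "x \<in> A i" "\<And>m. m \<in> A i \<Longrightarrow> m \<le> x" using fin [OF less.prems] unfolding x_def by auto
        define j where "j = (LEAST j. x < c j)"
        have xk: "x < c k" using none x(1) by (meson not_le)
        then have j: "x < c j" "j \<le> k" unfolding j_def by (auto intro: LeastI Least_le)
        have before: "c h \<le> x" if "h < j" for h
          using that not_less_Least unfolding j_def by (metis not_le)
        have "j \<noteq> 0" using j(1) c0 by (metis not_less_zero)
        then obtain h where h: "j = Suc h" using not0_implies_Suc by blast
        have "j < i" using j Suc by simp
        have hA: "c h \<in> A h" using less.IH [of h] less.prems \<open>j < i\<close> h by simp
        have jA: "c j \<in> A j" using less.IH [of j] less.prems \<open>j < i\<close> by simp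
        obtain y u where yu: "y \<in> A j" "u \<in> A i" "y \<le> u"
          using not_beyond [of j i] \<open>j \<noteq> 0\<close> \<open>j < i\<close> less.prems by blast
        then have "y \<le> x" using x(2) le_trans by blast
        \<comment> \<open>\<open>c j\<close> is the least element of \<open>A j\<close> from
          \<open>c h\<close> on, and it exceeds \<open>x\<close>. So \<open>A j\<close> has nothing
          between \<open>c h\<close> and \<open>x\<close>, which \<open>no_jump\<close> will
          contradict.\<close>
        moreover have beyond: "x < m" if "m \<in> A j" "c h \<le> m" for m
          using least [of m h] that h j(1) by simp
        ultimately have "y < c h" using yu(1) by (meson not_le)
        then obtain m where "m \<in> A j" "c h \<le> m" "m \<le> x"
          using no_jump [of h j i "c h" x y "c j"] before [of h] h \<open>j < i\<close> less.prems hA jA x(1) yu(1) j(1)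
          by auto
        then show False using beyond by fastforce
      qed
      then have "c i \<in> A i \<and> c k \<le> c i" unfolding Suc cS by (rule LeastI_ex)
      then show ?thesis using Suc by simp
    qed
  qed
  have "c i \<le> c j" if "i \<le> j" "j < n" for i j
    using that
  proof (induction j rule: dec_induct)
    case (step m)
    then show ?case using main [of "Suc m"] by force
  qed simp
  then show ?thesis using main by blast
qed

section \<open>Regions and gaps\<close>

locale arc_family =
  fixes W :: "'a set" and R' :: "'a \<Rightarrow> complex set"
  assumes finite_W: "finite W"
    and arcs: "w \<in> W \<Longrightarrow> closed_arc (R' w)"
    and distinct: "distinct_endpoints W R'"
begin

lemma arc_connected: "w \<in> W \<Longrightarrow> connected (R' w)"
  and arc_subset_circle: "w \<in> W \<Longrightarrow> R' w \<subseteq> circle"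
  using arcs closed_arc_connected closed_arc_subset_circle by blast+

text \<open>Equal arcs have equal endpoint sets, and these are nonempty. Injectivity matters because
  regions are defined by removing arcs, not vertices, from the family.\<close>

lemma arcs_inj: "inj_on R' W"
proof (rule inj_onI, rule ccontr)
  fix u w assume *: "u \<in> W" "w \<in> W" "R' u = R' w" "u \<noteq> w"
  then have "endpoints (R' u) = {}"
    using distinct unfolding distinct_endpoints_def disjoint_family_on_def by fastforce
  then show False using closed_arc_ends [OF arcs [OF *(1)]] by auto
qed

lemma Reg_iff: "p \<in> Reg W R' C \<longleftrightarrow> p \<in> circle \<and> (\<forall>w\<in>W. p \<in> R' w \<longleftrightarrow> w \<in> C)"
proof -
  have "R' w \<in> R' ` (C \<inter> W) \<longleftrightarrow> w \<in> C" if "w \<in> W" for w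
    using that arcs_inj by (auto dest: inj_onD)
  moreover have "p \<in> Reg W R' C \<longleftrightarrow> p \<in> circle \<and> (\<forall>w\<in>C \<inter> W. p \<in> R' w) \<and>
      (\<forall>w\<in>W. R' w \<notin> R' ` (C \<inter> W) \<longrightarrow> p \<notin> R' w)"
    unfolding Reg_def Reg_plus_def Reg_minus_def Pre_def by auto
  ultimately show ?thesis by auto
qed

lemma Reg_subset_circle: "Reg W R' C \<subseteq> circle"
  using Reg_iff by blast

text \<open>By \<open>Reg_iff\<close>, nonempty regions are level sets of the map sending a point to
  the set of given arcs that contain it.\<close>

lemma Reg_eq_if_meet:
  assumes "p \<in> Reg W R' C" "p \<in> Reg W R' C'"
  shows "Reg W R' C = Reg W R' C'"
  using assms unfolding set_eq_iff Reg_iff by blast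

text \<open>Different regions are told apart by some \<open>w\<close> in exactly one of the two
  cliques. Its connected arc would contain two of the four points and miss the two alternating with
  them.\<close>

lemma Reg_noncrossing:
  assumes "cw \<beta> a \<in> Reg W R' C" "cw \<beta> b \<in> Reg W R' C'" "cw \<beta> c \<in> Reg W R' C" "cw \<beta> d \<in> Reg W R' C'"
    and "a < b" "b < c" "c < d" "d < a + 2 * pi"
  shows "Reg W R' C = Reg W R' C'"
proof (rule ccontr)
  assume "Reg W R' C \<noteq> Reg W R' C'"
  then obtain w where w: "w \<in> W" "w \<in> C \<longleftrightarrow> w \<notin> C'"
    unfolding set_eq_iff Reg_iff by blast
  note no_alt = connected_no_alternation [OF arc_connected arc_subset_circle, OF w(1) w(1)]
  show False
  proof (cases "w \<in> C")
    case True
    show ?thesis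
      by (rule no_alt [of \<beta> a b c d]) (use assms w True in \<open>auto simp: Reg_iff\<close>)
  next
    case False
    show ?thesis
      \<comment> \<open>Now the arc contains the points of \<open>C'\<close>, so the pattern is read
        from \<open>b\<close> on, with \<open>a\<close> one turn later.\<close>
      by (rule no_alt [of \<beta> b c d "a + 2 * pi"]) (use assms w False in \<open>auto simp: Reg_iff\<close>)
  qed
qed

section \<open>Gaps of a region\<close>

lemma gap_connected: "J \<in> gaps W R' C \<Longrightarrow> connected J"
  and gap_subset_circle: "J \<in> gaps W R' C \<Longrightarrow> J \<subseteq> circle"
  and gap_disjoint_Reg: "J \<in> gaps W R' C \<Longrightarrow> p \<in> J \<Longrightarrow> p \<notin> Reg W R' C"
  unfolding gaps_def by (auto simp: in_components_connected dest: in_components_subset)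

lemma interval_subset_gap:
  assumes "J \<in> gaps W R' C" "cw \<beta> u \<in> J" "s \<le> u" "u \<le> t"
    and "\<And>x. s \<le> x \<Longrightarrow> x \<le> t \<Longrightarrow> cw \<beta> x \<notin> Reg W R' C"
  shows "cw \<beta> ` {s..t} \<subseteq> J"
proof (rule components_maximal)
  show "J \<in> components (circle - Reg W R' C)" using assms(1) unfolding gaps_def .
  show "connected (cw \<beta> ` {s..t})" by (intro connected_continuous_image continuous_on_cw) simp
  show "cw \<beta> ` {s..t} \<subseteq> circle - Reg W R' C" using assms by auto
  show "J \<inter> cw \<beta> ` {s..t} \<noteq> {}" using assms by (auto simp: disjoint_iff)
qed

lemma gap_contains_interval:
  assumes "s \<le> t" "\<And>x. s \<le> x \<Longrightarrow> x \<le> t \<Longrightarrow> cw \<beta> x \<notin> Reg W R' C"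
  obtains J where "J \<in> gaps W R' C" "cw \<beta> ` {s..t} \<subseteq> J"
proof -
  have "cw \<beta> s \<in> circle - Reg W R' C" using assms by simp
  then obtain J where J: "J \<in> gaps W R' C" "cw \<beta> s \<in> J"
    unfolding gaps_def by (metis UnionE Union_components)
  moreover have "cw \<beta> ` {s..t} \<subseteq> J"
    using interval_subset_gap [OF J order_refl assms] .
  ultimately show thesis using that by blast
qed

text \<open>If \<open>p\<close> were outside \<open>J\<close>, both ways around the circle from
  \<open>q\<close> to \<open>p\<close> would have to meet the region of \<open>C\<close>, and the
  two regions would alternate.\<close>

lemma Reg_within_gap:
  assumes J: "J \<in> gaps W R' C" and q: "q \<in> J" "q \<in> Reg W R' C'" and p: "p \<in> Reg W R' C'"
  shows "p \<in> J"
proof (rule ccontr)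
  assume pJ: "p \<notin> J"
  have "q \<notin> Reg W R' C" using gap_disjoint_Reg [OF J q(1)] .
  then have ne: "Reg W R' C' \<noteq> Reg W R' C" using q by blast
  then have p': "p \<notin> Reg W R' C" using p Reg_eq_if_meet by blast
  obtain \<tau> where \<tau>: "q = cw (Arg q) \<tau>" "0 \<le> \<tau>" "\<tau> < 0 + 2 * pi"
    using circle_cwE [of q 0 "Arg q"] q(2) Reg_subset_circle by blast
  \<comment> \<open>Recentred so that \<open>q\<close> has the angles 0 and 2 * pi, the starting
    points of the two ways to \<open>p\<close>.\<close>
  define \<beta> where "\<beta> = Arg q - \<tau>"
  have q0: "q = cw \<beta> 0" using \<tau> cw_add [of "Arg q" \<tau> 0] unfolding \<beta>_def by simp
  obtain t where t: "p = cw \<beta> t" "0 \<le> t" "t < 0 + 2 * pi"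
    using circle_cwE [of p 0 \<beta>] p Reg_subset_circle by blast
  have "\<exists>y. 0 \<le> y \<and> y \<le> t \<and> cw \<beta> y \<in> Reg W R' C"
  proof (rule ccontr)
    assume "\<not> ?thesis"
    then have "cw \<beta> ` {0..t} \<subseteq> J"
      using q(1) t(2) unfolding q0 by (intro interval_subset_gap [OF J, of \<beta> 0]) auto
    then show False using pJ t by (simp add: image_subset_iff)
  qed
  then obtain y where y: "0 \<le> y" "y \<le> t" "cw \<beta> y \<in> Reg W R' C" by blast
  have q2: "q = cw \<beta> (2 * pi)" using cw_periodic [of \<beta> 0] q0 by simp
  have "\<exists>z. t \<le> z \<and> z \<le> 2 * pi \<and> cw \<beta> z \<in> Reg W R' C"
  proof (rule ccontr)
    assume "\<not> ?thesis"
    then have "cw \<beta> ` {t..2 * pi} \<subseteq> J"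
      using q(1) t(3) unfolding q2 by (intro interval_subset_gap [OF J, of \<beta> "2 * pi"]) auto
    then show False using pJ t by (simp add: image_subset_iff)
  qed
  then obtain z where z: "t \<le> z" "z \<le> 2 * pi" "cw \<beta> z \<in> Reg W R' C" by blast
  have "y \<noteq> 0" "y \<noteq> t" "z \<noteq> t" "z \<noteq> 2 * pi"
    using y z p' t(1) q0 q2 \<open>q \<notin> Reg W R' C\<close> by auto
  then have "Reg W R' C' = Reg W R' C"
    using Reg_noncrossing [of \<beta> 0 C' y C t z] y z t p q q0 by auto
  then show False using ne by blast
qed

section \<open>Ends of the given arcs and regions near a point\<close>

definition arc_ends :: "'a \<Rightarrow> complex set" where
  "arc_ends w = (SOME e. finite e \<and> e \<noteq> {} \<and> e \<subseteq> endpoints (R' w) \<and>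
    (\<forall>Z. connected Z \<longrightarrow> Z \<subseteq> circle \<longrightarrow> Z \<inter> e = {} \<longrightarrow> Z \<subseteq> R' w \<or> Z \<inter> R' w = {}) \<and>
    (\<forall>\<beta> u. cw \<beta> u \<in> e \<longrightarrow> cw \<beta> u \<in> R' w \<and>
       ((\<forall>\<^sub>F x in at_right u. cw \<beta> x \<in> R' w) \<or> (\<forall>\<^sub>F x in at_left u. cw \<beta> x \<in> R' w))))"

lemma
  assumes "w \<in> W"
  shows finite_arc_ends: "finite (arc_ends w)"
    and arc_ends_subset: "arc_ends w \<subseteq> endpoints (R' w)"
    and connected_avoiding_ends_cases:
      "\<lbrakk>connected Z; Z \<subseteq> circle; Z \<inter> arc_ends w = {}\<rbrakk> \<Longrightarrow> Z \<subseteq> R' w \<or> Z \<inter> R' w = {}"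
    and arc_at_end: "cw \<beta> u \<in> arc_ends w \<Longrightarrow> cw \<beta> u \<in> R' w"
      "cw \<beta> u \<in> arc_ends w \<Longrightarrow>
        (\<forall>\<^sub>F x in at_right u. cw \<beta> x \<in> R' w) \<or> (\<forall>\<^sub>F x in at_left u. cw \<beta> x \<in> R' w)"
proof -
  note P = someI_ex [OF closed_arc_ends [OF arcs [OF assms]], folded arc_ends_def]
  show "finite (arc_ends w)" using P by (rule conjunct1)
  note P = conjunct2 [OF conjunct2 [OF P]]
  show "arc_ends w \<subseteq> endpoints (R' w)" using P by (rule conjunct1)
  note P = conjunct2 [OF P]
  show "Z \<subseteq> R' w \<or> Z \<inter> R' w = {}"
    if "connected Z" "Z \<subseteq> circle" "Z \<inter> arc_ends w = {}"
    by (rule conjunct1 [OF P, rule_format, OF that])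
  note P = conjunct2 [OF P]
  show "cw \<beta> u \<in> R' w" if "cw \<beta> u \<in> arc_ends w"
    by (rule conjunct1 [OF P [rule_format, OF that]])
  show "(\<forall>\<^sub>F x in at_right u. cw \<beta> x \<in> R' w) \<or> (\<forall>\<^sub>F x in at_left u. cw \<beta> x \<in> R' w)"
    if "cw \<beta> u \<in> arc_ends w"
    by (rule conjunct2 [OF P [rule_format, OF that]])
qed

lemma arc_ends_disjoint:
  assumes "u \<in> W" "w \<in> W" "p \<in> arc_ends u" "p \<in> arc_ends w"
  shows "u = w"
proof (rule ccontr)
  assume "u \<noteq> w"
  then have "endpoints (R' u) \<inter> endpoints (R' w) = {}"
    using disjoint_family_onD [OF distinct [unfolded distinct_endpoints_def] assms(1,2)] by blast
  then show False using arc_ends_subset [OF assms(1)] arc_ends_subset [OF assms(2)] assms(3,4) by blast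
qed

lemma connected_avoiding_ends:
  assumes "w \<in> W" "connected Z" "Z \<subseteq> circle" "Z \<inter> arc_ends w = {}" "p \<in> Z" "q \<in> Z"
  shows "p \<in> R' w \<longleftrightarrow> q \<in> R' w"
  using connected_avoiding_ends_cases [OF assms(1-4)] assms(5,6) by blast

text \<open>There are finitely many ends, so a small interval around \<open>u\<close> avoids them,
  and its connected image lies inside or outside the arc.\<close>

lemma arc_locally_constant:
  assumes "w \<in> W" "cw \<beta> u \<notin> arc_ends w"
  shows "\<forall>\<^sub>F x in nhds u. cw \<beta> x \<in> R' w \<longleftrightarrow> cw \<beta> u \<in> R' w"
proof -
  have "open (- arc_ends w)" by (simp add: finite_arc_ends [OF assms(1)] finite_imp_closed open_Compl)
  then have "open (cw \<beta> -` (- arc_ends w))"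
    by (rule open_vimage) (rule continuous_on_cw)
  moreover have "u \<in> cw \<beta> -` (- arc_ends w)" using assms(2) by simp
  ultimately obtain r where r: "r > 0" "ball u r \<subseteq> cw \<beta> -` (- arc_ends w)"
    by (rule openE)
  have "cw \<beta> x \<in> R' w \<longleftrightarrow> cw \<beta> u \<in> R' w" if "x \<in> ball u r" for x
  proof (rule connected_avoiding_ends [OF assms(1)])
    show "connected (cw \<beta> ` ball u r)"
      by (intro connected_continuous_image continuous_on_cw connected_ball)
    show "cw \<beta> ` ball u r \<inter> arc_ends w = {}" using r(2) by blast
    show "cw \<beta> u \<in> cw \<beta> ` ball u r" using r(1) by (intro imageI) simp
  qed (use that in auto)
  moreover have "\<forall>\<^sub>F x in nhds u. x \<in> ball u r"
    using r(1) by (intro eventually_nhds_in_open) auto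
  ultimately show ?thesis by (auto elim: eventually_mono)
qed

lemma Reg_interior:
  assumes "cw \<beta> u \<in> Reg W R' C" "\<And>w. w \<in> W \<Longrightarrow> cw \<beta> u \<notin> arc_ends w"
  shows "\<forall>\<^sub>F x in nhds u. cw \<beta> x \<in> Reg W R' C"
proof -
  have "\<forall>\<^sub>F x in nhds u. \<forall>w\<in>W. cw \<beta> x \<in> R' w \<longleftrightarrow> cw \<beta> u \<in> R' w"
    using arc_locally_constant assms(2) by (intro eventually_ball_finite finite_W) blast
  then show ?thesis
    by eventually_elim (use assms(1) in \<open>auto simp: Reg_iff\<close>)
qed

text \<open>This is where distinct endpoints are needed: at most one arc ends at a given point of a region.\<close>

lemma Reg_one_sided:
  assumes u: "cw \<beta> u \<in> Reg W R' C"
  shows "(\<forall>\<^sub>F x in at_right u. cw \<beta> x \<in> Reg W R' C) \<or> (\<forall>\<^sub>F x in at_left u. cw \<beta> x \<in> Reg W R' C)"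
proof (cases "\<exists>w\<in>W. cw \<beta> u \<in> arc_ends w")
  case False
  then have *: "\<forall>\<^sub>F x in nhds u. cw \<beta> x \<in> Reg W R' C" using Reg_interior [OF u] by blast
  show ?thesis by (rule disjI1, rule filter_leD [OF _ *]) (simp add: at_within_def)
next
  case True
  then obtain w where w: "w \<in> W" "cw \<beta> u \<in> arc_ends w" by blast
  have "\<forall>\<^sub>F x in nhds u. \<forall>v\<in>W - {w}. cw \<beta> x \<in> R' v \<longleftrightarrow> cw \<beta> u \<in> R' v"
  proof (intro eventually_ball_finite ballI)
    fix v assume "v \<in> W - {w}"
    then show "\<forall>\<^sub>F x in nhds u. cw \<beta> x \<in> R' v \<longleftrightarrow> cw \<beta> u \<in> R' v"
      using arc_ends_disjoint [OF _ w(1) _ w(2)] arc_locally_constant by blast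
  qed (simp add: finite_W)
  then have others: "\<forall>\<^sub>F x in at u within S. \<forall>v\<in>W - {w}. cw \<beta> x \<in> R' v \<longleftrightarrow> cw \<beta> u \<in> R' v" for S
    by (rule filter_leD [rotated]) (simp add: at_within_def)
  have "cw \<beta> u \<in> R' w" and
    side: "(\<forall>\<^sub>F x in at_right u. cw \<beta> x \<in> R' w) \<or> (\<forall>\<^sub>F x in at_left u. cw \<beta> x \<in> R' w)"
    using arc_at_end [OF w] by blast+
  \<comment> \<open>The arc contains its own end, so \<open>w\<close> belongs to \<open>C\<close>.
    Hence the region continues on the side on which this arc does.\<close>
  then have wC: "w \<in> C" using u w(1) by (auto simp: Reg_iff)
  have "\<forall>\<^sub>F x in at u within S. cw \<beta> x \<in> Reg W R' C"
    if "\<forall>\<^sub>F x in at u within S. cw \<beta> x \<in> R' w" for S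
    using that others [of S] by eventually_elim (use u wC in \<open>auto simp: Reg_iff\<close>)
  then show ?thesis using side by blast
qed

end

section \<open>From a representation to an ordering\<close>

lemma finite_max_cliques: "simple_graph V E \<Longrightarrow> finite (max_cliques V E)"
  unfolding simple_graph_def max_cliques_def is_clique_def
  by (rule finite_subset [of _ "Pow V"]) auto

lemma clique_extends_to_max_clique:
  assumes "simple_graph V E" "is_clique V E C"
  obtains M where "M \<in> max_cliques V E" "C \<subseteq> M"
proof -
  let ?K = "{K. is_clique V E K \<and> C \<subseteq> K}"
  have "finite ?K"
    by (rule finite_subset [of _ "Pow V"]) (use assms(1) in \<open>auto simp: simple_graph_def is_clique_def\<close>)
  moreover have "?K \<noteq> {}" using assms(2) by auto
  ultimately obtain M where M: "M \<in> ?K" "\<forall>K\<in>?K. M \<subseteq> K \<longrightarrow> M = K"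
    using finite_has_maximal [of ?K] by auto
  then have "M \<in> max_cliques V E" unfolding max_cliques_def by auto
  then show thesis using that M(1) by simp
qed

lemma max_clique_subset: "C \<in> max_cliques V E \<Longrightarrow> C \<subseteq> V"
  and max_clique_adjacent: "C \<in> max_cliques V E \<Longrightarrow> u \<in> C \<Longrightarrow> v \<in> C \<Longrightarrow> u \<noteq> v \<Longrightarrow> (u, v) \<in> E"
  unfolding max_cliques_def is_clique_def by simp_all

lemma max_clique_absorbs:
  assumes "simple_graph V E" "C \<in> max_cliques V E" "v \<in> V" "\<And>u. u \<in> C \<Longrightarrow> u \<noteq> v \<Longrightarrow> (u, v) \<in> E"
  shows "v \<in> C"
proof -
  have "sym E" using assms(1) by (simp add: simple_graph_def)
  then have "(v, u) \<in> E" if "u \<in> C" "u \<noteq> v" for u using assms(4) [OF that] by (rule symD)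
  then have "is_clique V E (insert v C)"
    using assms(3,4) max_clique_subset [OF assms(2)] max_clique_adjacent [OF assms(2)]
    unfolding is_clique_def by simp
  then have "insert v C = C" using assms(2) unfolding max_cliques_def by auto
  then show ?thesis by blast
qed

locale partial_representation = arc_family W R' for W :: "'a set" and R' +
  fixes V :: "'a set" and E :: "('a \<times> 'a) set" and D :: "'a set"
  assumes graph: "simple_graph V E"
    and W_subset: "W \<subseteq> V"
    and partial: "helly_rep W (induced_edges E W) R'"
    and Reg_nonempty: "C \<in> max_cliques V E \<Longrightarrow> Reg W R' C \<noteq> {}"
    and D_max: "D \<in> max_cliques V E"
begin

abbreviation "X \<equiv> max_cliques V E"

lemma finite_X: "finite X"
  using finite_max_cliques [OF graph] .

lemma ordering_if_extension:
  assumes R: "helly_rep V E R" and ext: "rep_extends W R' R"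
  shows "\<exists>pD\<in>Reg W R' D. \<exists>L. linear_extension X (clique_prec V E W R' D pD) L \<and>
    (\<forall>v\<in>V. consecutive X (cyclic_order L) (vertex_cliques V E v)) \<and>
    (\<forall>C\<in>X. \<forall>J\<in>gaps W R' C. consecutive X (cyclic_order L) (gap_cliques V E W R' J))"
proof -
  have arc: "closed_arc (R v)" if "v \<in> V" for v
    using R that by (simp add: helly_rep_def circular_arc_rep_def)
  have adj: "R u \<inter> R v \<noteq> {} \<longleftrightarrow> (u, v) \<in> E" if "u \<in> V" "v \<in> V" "u \<noteq> v" for u v
    using R that by (simp add: helly_rep_def circular_arc_rep_def)
  have "\<exists>p. p \<in> circle \<and> (\<forall>v\<in>C. p \<in> R v)" if C: "C \<in> X" for C
  proof -
    have meet: "A \<inter> B \<noteq> {}" if "A \<in> R ` C" "B \<in> R ` C" for A B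
    proof -
      obtain u v where uv: "u \<in> C" "v \<in> C" "A = R u" "B = R v" using \<open>A \<in> R ` C\<close> \<open>B \<in> R ` C\<close> by blast
      show ?thesis
      proof (cases "u = v")
        case True
        then show ?thesis using uv closed_arc_nonempty [OF arc [of u]] max_clique_subset [OF C]
          by (simp add: subset_iff)
      next
        case False
        then have "(u, v) \<in> E" using max_clique_adjacent [OF C uv(1,2)] by blast
        then show ?thesis using adj [of u v] False uv max_clique_subset [OF C] by (simp add: subset_iff)
      qed
    qed
    have sub: "R ` C \<subseteq> R ` V" using max_clique_subset [OF C] by blast
    have helly: "\<forall>F\<subseteq>R ` V. (\<forall>A\<in>F. \<forall>B\<in>F. A \<inter> B \<noteq> {}) \<longrightarrow> (\<exists>p\<in>circle. \<forall>A\<in>F. p \<in> A)"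
      using R unfolding helly_rep_def by (rule conjunct2)
    have "\<exists>p\<in>circle. \<forall>A\<in>R ` C. p \<in> A"
      by (rule helly [rule_format, OF sub meet])
    then show ?thesis by blast
  qed
  then have "\<forall>C\<in>X. \<exists>p. p \<in> circle \<and> (\<forall>v\<in>C. p \<in> R v)" by blast
  then obtain p where "\<forall>C\<in>X. p C \<in> circle \<and> (\<forall>v\<in>C. p C \<in> R v)" by (rule bchoice [elim_format]) blast
  then have p: "\<And>C. C \<in> X \<Longrightarrow> p C \<in> circle" "\<And>C v. C \<in> X \<Longrightarrow> v \<in> C \<Longrightarrow> p C \<in> R v"
    by auto
  \<comment> \<open>A vertex whose arc contains the point of \<open>C\<close> meets the arcs of all
    vertices of \<open>C\<close>, so maximality puts it into \<open>C\<close>.\<close>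
  have p_iff: "p C \<in> R v \<longleftrightarrow> v \<in> C" if "C \<in> X" "v \<in> V" for C v
  proof
    assume "p C \<in> R v"
    have "(u, v) \<in> E" if u: "u \<in> C" "u \<noteq> v" for u
    proof -
      have "u \<in> V" using max_clique_subset [OF \<open>C \<in> X\<close>] u(1) by blast
      moreover have "R u \<inter> R v \<noteq> {}" using p(2) [OF \<open>C \<in> X\<close> u(1)] \<open>p C \<in> R v\<close> by blast
      ultimately show ?thesis using adj [OF _ \<open>v \<in> V\<close> u(2)] by simp
    qed
    then show "v \<in> C" by (rule max_clique_absorbs [OF graph that])
  qed (use p(2) that in blast)
  have p_Reg: "p C \<in> Reg W R' C" if "C \<in> X" for C
    unfolding Reg_iff using p_iff [OF that] p(1) [OF that] ext W_subset by (auto simp: rep_extends_def subset_iff)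
  have "\<forall>C\<in>X. \<exists>t. 0 \<le> t \<and> t < 2 * pi \<and> p C = cw (Arg (p D)) t"
  proof
    fix C assume "C \<in> X"
    show "\<exists>t. 0 \<le> t \<and> t < 2 * pi \<and> p C = cw (Arg (p D)) t"
      by (rule circle_cwE [OF p(1) [OF \<open>C \<in> X\<close>], of 0 "Arg (p D)"]) auto
  qed
  then obtain \<phi> where "\<forall>C\<in>X. 0 \<le> \<phi> C \<and> \<phi> C < 2 * pi \<and> p C = cw (Arg (p D)) (\<phi> C)"
    by (rule bchoice [elim_format]) blast
  then have \<phi>: "\<And>C. C \<in> X \<Longrightarrow> 0 \<le> \<phi> C" "\<And>C. C \<in> X \<Longrightarrow> \<phi> C < 2 * pi"
    "\<And>C. C \<in> X \<Longrightarrow> p C = cw (Arg (p D)) (\<phi> C)"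
    by auto
  let ?\<beta> = "Arg (p D)"
  have "cw ?\<beta> 0 = p D"
    using rcis_cmod_Arg [of "p D"] p(1) [OF D_max] by (simp add: cw_def circle_def rcis_def)
  then have pD: "cw ?\<beta> 0 = p D" "\<phi> D = 0"
    using \<phi> [OF D_max] cw_inj [of ?\<beta> 0 "\<phi> D"] by auto
  have inj: "inj_on \<phi> X"
  proof (rule inj_onI)
    fix C C' assume *: "C \<in> X" "C' \<in> X" "\<phi> C = \<phi> C'"
    then have "p C = p C'" using \<phi>(3) by simp
    then have "v \<in> C \<longleftrightarrow> v \<in> C'" if "v \<in> V" for v using p_iff that * by metis
    then show "C = C'" using max_clique_subset * by blast
  qed
  define L where "L = {(C, C'). C \<in> X \<and> C' \<in> X \<and> \<phi> C < \<phi> C'}"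
  have "total_on X L"
  proof (rule total_onI)
    fix C C' assume "C \<in> X" "C' \<in> X" "C \<noteq> C'"
    then have "\<phi> C \<noteq> \<phi> C'" using inj_onD [OF inj] by blast
    then show "(C, C') \<in> L \<or> (C', C) \<in> L" using \<open>C \<in> X\<close> \<open>C' \<in> X\<close> by (auto simp: L_def)
  qed
  then have "strict_linear_order_on X L"
    unfolding strict_linear_order_on_def by (auto simp: L_def trans_def irrefl_def)
  moreover have "clique_prec V E W R' D (p D) \<subseteq> L"
  proof clarify
    fix C C' assume CC': "(C, C') \<in> clique_prec V E W R' D (p D)"
    then have X: "C \<in> X" "C' \<in> X" "C' \<noteq> D" unfolding clique_prec_def by auto
    have "\<phi> C < \<phi> C'"
    proof (cases "C = D")
      case True
      moreover have "\<phi> C' \<noteq> \<phi> D" using inj_onD [OF inj _ X(2) D_max] X(3) by blast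
      ultimately show ?thesis using \<phi>(1) [OF X(2)] pD(2) by simp
    next
      case False
      then have "clockwise_less (p D) (p C) (p C')"
        using CC' p_Reg X unfolding clique_prec_def by blast
      then show ?thesis
        using clockwise_less_cw [of "\<phi> C" "\<phi> C'" ?\<beta>] \<phi> X pD(1) by simp
    qed
    then show "(C, C') \<in> L" using X by (simp add: L_def)
  qed
  ultimately have "linear_extension X (clique_prec V E W R' D (p D)) L"
    unfolding linear_extension_def by (auto simp: L_def)
  \<comment> \<open>One argument for both conditions: \<open>Z\<close> will be the arc of a vertex
    or a gap.\<close>
  moreover have con: "consecutive X (cyclic_order L) {C \<in> X. p C \<in> Z}"
    if Z: "connected Z" "Z \<subseteq> circle" for Z
  proof (rule consecutive_if_no_alternation [OF finite_X inj L_def])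
    fix x x' y y'
    assume *: "x \<in> {C \<in> X. p C \<in> Z}" "x' \<in> {C \<in> X. p C \<in> Z}"
      "y \<in> X - {C \<in> X. p C \<in> Z}" "y' \<in> X - {C \<in> X. p C \<in> Z}"
    then have Z': "cw ?\<beta> (\<phi> x) \<in> Z" "cw ?\<beta> (\<phi> x') \<in> Z" "cw ?\<beta> (\<phi> y) \<notin> Z" "cw ?\<beta> (\<phi> y') \<notin> Z"
      using \<phi>(3) by auto
    have X: "x \<in> X" "x' \<in> X" "y \<in> X" "y' \<in> X" using * by auto
    have "\<not> (\<phi> x < \<phi> y \<and> \<phi> y < \<phi> x' \<and> \<phi> x' < \<phi> y')"
    proof
      assume "\<phi> x < \<phi> y \<and> \<phi> y < \<phi> x' \<and> \<phi> x' < \<phi> y'"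
      then show False
        using connected_no_alternation [OF Z Z'(1,3,2,4)] \<phi>(1) [OF X(1)] \<phi>(2) [OF X(4)] by simp
    qed
    \<comment> \<open>This pattern becomes the previous one when \<open>y\<close> is moved one turn
      ahead.\<close>
    moreover have "\<not> (\<phi> y < \<phi> x \<and> \<phi> x < \<phi> y' \<and> \<phi> y' < \<phi> x')"
    proof
      assume "\<phi> y < \<phi> x \<and> \<phi> x < \<phi> y' \<and> \<phi> y' < \<phi> x'"
      then show False
        using connected_no_alternation [OF Z Z'(1,4,2), of "\<phi> y + 2 * pi"] Z'(3)
          \<phi>(1) [OF X(3)] \<phi>(2) [OF X(2)] by simp
    qed
    ultimately show "\<not> (\<phi> x < \<phi> y \<and> \<phi> y < \<phi> x' \<and> \<phi> x' < \<phi> y') \<and>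
        \<not> (\<phi> y < \<phi> x \<and> \<phi> x < \<phi> y' \<and> \<phi> y' < \<phi> x')" ..
  qed auto
  moreover have "vertex_cliques V E v = {C \<in> X. p C \<in> R v}" if "v \<in> V" for v
    unfolding vertex_cliques_def using p_iff that by blast
  moreover have "gap_cliques V E W R' J = {C \<in> X. p C \<in> J}" if "J \<in> gaps W R' C" for J C
    unfolding gap_cliques_def using p_Reg Reg_within_gap [OF that] by blast
  ultimately have "linear_extension X (clique_prec V E W R' D (p D)) L \<and>
    (\<forall>v\<in>V. consecutive X (cyclic_order L) (vertex_cliques V E v)) \<and>
    (\<forall>C\<in>X. \<forall>J\<in>gaps W R' C. consecutive X (cyclic_order L) (gap_cliques V E W R' J))"
    using closed_arc_connected [OF arc] closed_arc_subset_circle [OF arc]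
      gap_connected gap_subset_circle by simp
  then show ?thesis using p_Reg [OF D_max] by blast
qed

section \<open>From an ordering to a representation\<close>

text \<open>Each clique point is thickened to a stretch of length \<delta> inside its region, and a
  new arc ends only \<delta> after its last clique point. It is then a genuine arc even if its
  vertex lies in a single maximal clique.\<close>

lemma extension_if_points:
  fixes \<phi> :: "'a set \<Rightarrow> real"
  assumes inj: "inj_on \<phi> X" and L: "L = {(C, C'). C \<in> X \<and> C' \<in> X \<and> \<phi> C < \<phi> C'}"
    and spread: "\<And>C C'. C \<in> X \<Longrightarrow> C' \<in> X \<Longrightarrow> \<phi> C < \<phi> C' + 2 * pi"
    and interior: "\<And>C. C \<in> X \<Longrightarrow> \<forall>\<^sub>F x in nhds (\<phi> C). cw \<beta> x \<in> Reg W R' C"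
    and con: "\<And>v. v \<in> V \<Longrightarrow> consecutive X (cyclic_order L) (vertex_cliques V E v)"
  shows "\<exists>R. helly_rep V E R \<and> rep_extends W R' R"
proof -
  have sym: "sym E" using graph by (simp add: simple_graph_def)
  \<comment> \<open>The stretches must stay inside the regions and end before the next clique point,
    also across the full turn.\<close>
  have "\<forall>\<^sub>F \<delta> in at_right 0. (\<forall>C\<in>X. \<forall>x. \<phi> C \<le> x \<and> x \<le> \<phi> C + \<delta> \<longrightarrow> cw \<beta> x \<in> Reg W R' C) \<and>
      (\<forall>C\<in>X. \<forall>C'\<in>X. (\<phi> C < \<phi> C' \<longrightarrow> \<phi> C + \<delta> < \<phi> C') \<and> \<phi> C + \<delta> < \<phi> C' + 2 * pi)"
  proof (intro eventually_conj eventually_ball_finite finite_X ballI)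
    fix C assume "C \<in> X"
    then obtain r where r: "r > 0" "\<And>x. dist x (\<phi> C) < r \<Longrightarrow> cw \<beta> x \<in> Reg W R' C"
      using interior [of C] unfolding eventually_nhds_metric by auto
    have "\<forall>\<^sub>F \<delta> in at_right 0. \<delta> \<in> {0<..<r}" by (rule eventually_at_right_real [OF r(1)])
    then show "\<forall>\<^sub>F \<delta> in at_right 0. \<forall>x. \<phi> C \<le> x \<and> x \<le> \<phi> C + \<delta> \<longrightarrow> cw \<beta> x \<in> Reg W R' C"
      by eventually_elim (use r in \<open>auto simp: dist_real_def\<close>)
  next
    fix C C' assume "C \<in> X" "C' \<in> X"
    show "\<forall>\<^sub>F \<delta> in at_right 0. \<phi> C < \<phi> C' \<longrightarrow> \<phi> C + \<delta> < \<phi> C'"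
    proof (cases "\<phi> C < \<phi> C'")
      case True
      then have "\<forall>\<^sub>F \<delta> in at_right 0. \<delta> \<in> {0<..<\<phi> C' - \<phi> C}" by (intro eventually_at_right_real) simp
      then show ?thesis by eventually_elim auto
    qed simp
    have "\<forall>\<^sub>F \<delta> in at_right 0. \<delta> \<in> {0<..<\<phi> C' + 2 * pi - \<phi> C}"
      using spread [OF \<open>C \<in> X\<close> \<open>C' \<in> X\<close>] by (intro eventually_at_right_real) simp
    then show "\<forall>\<^sub>F \<delta> in at_right 0. \<phi> C + \<delta> < \<phi> C' + 2 * pi" by eventually_elim auto
  qed
  then have "\<forall>\<^sub>F \<delta> in at_right 0. 0 < \<delta> \<and> (\<forall>C\<in>X. \<forall>x. \<phi> C \<le> x \<and> x \<le> \<phi> C + \<delta> \<longrightarrow> cw \<beta> x \<in> Reg W R' C) \<and>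
      (\<forall>C\<in>X. \<forall>C'\<in>X. (\<phi> C < \<phi> C' \<longrightarrow> \<phi> C + \<delta> < \<phi> C') \<and> \<phi> C + \<delta> < \<phi> C' + 2 * pi)"
    by (rule eventually_conj [OF eventually_at_right_less])
  from eventually_happens [OF this] obtain \<delta> where \<delta>: "0 < \<delta>"
    and blob: "\<And>C x. C \<in> X \<Longrightarrow> \<phi> C \<le> x \<Longrightarrow> x \<le> \<phi> C + \<delta> \<Longrightarrow> cw \<beta> x \<in> Reg W R' C"
    and sep: "\<And>C C'. C \<in> X \<Longrightarrow> C' \<in> X \<Longrightarrow> \<phi> C < \<phi> C' \<Longrightarrow> \<phi> C + \<delta> < \<phi> C'"
    and wrap: "\<And>C C'. C \<in> X \<Longrightarrow> C' \<in> X \<Longrightarrow> \<phi> C + \<delta> < \<phi> C' + 2 * pi"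
    by auto
  have "\<exists>a b. a \<in> X \<and> b \<in> X \<and> (\<forall>C\<in>X. v \<in> C \<longleftrightarrow>
      \<phi> a \<le> \<phi> C \<and> \<phi> C \<le> \<phi> b \<or> \<phi> b < \<phi> a \<and> (\<phi> C \<le> \<phi> b \<or> \<phi> a \<le> \<phi> C))" if v: "v \<in> V" for v
  proof -
    let ?S = "vertex_cliques V E v"
    have S: "?S \<subseteq> X" by (auto simp: vertex_cliques_def)
    \<comment> \<open>Every vertex lies in a maximal clique, so its cyclic interval is nonempty and
      has end cliques.\<close>
    have "is_clique V E {v}" using v by (simp add: is_clique_def)
    then obtain M where "M \<in> X" "{v} \<subseteq> M" using clique_extends_to_max_clique [OF graph] by blast
    then have "?S \<noteq> {}" by (auto simp: vertex_cliques_def)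
    then have "\<exists>a\<in>?S. \<exists>b\<in>?S. ?S =
        {C \<in> X. \<phi> a \<le> \<phi> C \<and> \<phi> C \<le> \<phi> b \<or> \<phi> b < \<phi> a \<and> (\<phi> C \<le> \<phi> b \<or> \<phi> a \<le> \<phi> C)}"
      using con [OF v] unfolding consecutive_iff_interval [OF inj L S] by simp
    then obtain a b where ab: "a \<in> ?S" "b \<in> ?S" and
      eq: "?S = {C \<in> X. \<phi> a \<le> \<phi> C \<and> \<phi> C \<le> \<phi> b \<or> \<phi> b < \<phi> a \<and> (\<phi> C \<le> \<phi> b \<or> \<phi> a \<le> \<phi> C)}"
      by (elim bexE)
    have "v \<in> C \<longleftrightarrow> \<phi> a \<le> \<phi> C \<and> \<phi> C \<le> \<phi> b \<or> \<phi> b < \<phi> a \<and> (\<phi> C \<le> \<phi> b \<or> \<phi> a \<le> \<phi> C)"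
      if "C \<in> X" for C
    proof -
      have "v \<in> C \<longleftrightarrow> C \<in> ?S" using that by (simp add: vertex_cliques_def)
      then show ?thesis using that unfolding eq by simp
    qed
    then show ?thesis using ab S by blast
  qed
  then have "\<forall>v\<in>V. \<exists>ab. fst ab \<in> X \<and> snd ab \<in> X \<and> (\<forall>C\<in>X. v \<in> C \<longleftrightarrow>
      \<phi> (fst ab) \<le> \<phi> C \<and> \<phi> C \<le> \<phi> (snd ab) \<or>
      \<phi> (snd ab) < \<phi> (fst ab) \<and> (\<phi> C \<le> \<phi> (snd ab) \<or> \<phi> (fst ab) \<le> \<phi> C))"
    by (simp add: split_paired_Ex)
  from bchoice [OF this] obtain ab where ab: "\<And>v. v \<in> V \<Longrightarrow> fst (ab v) \<in> X" "\<And>v. v \<in> V \<Longrightarrow> snd (ab v) \<in> X"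
    "\<And>v C. v \<in> V \<Longrightarrow> C \<in> X \<Longrightarrow> v \<in> C \<longleftrightarrow>
      \<phi> (fst (ab v)) \<le> \<phi> C \<and> \<phi> C \<le> \<phi> (snd (ab v)) \<or>
      \<phi> (snd (ab v)) < \<phi> (fst (ab v)) \<and> (\<phi> C \<le> \<phi> (snd (ab v)) \<or> \<phi> (fst (ab v)) \<le> \<phi> C)"
    by auto
  define s where "s v = \<phi> (fst (ab v))" for v
  \<comment> \<open>If the interval wraps, the last angle is lifted by a full turn.\<close>
  define t where "t v = (if s v \<le> \<phi> (snd (ab v)) then \<phi> (snd (ab v)) else \<phi> (snd (ab v)) + 2 * pi)" for v
  have st: "s v \<le> t v" "t v + \<delta> < s v + 2 * pi" if "v \<in> V" for v
  proof -
    have "\<phi> (snd (ab v)) + \<delta> < s v + 2 * pi" "s v < \<phi> (snd (ab v)) + 2 * pi"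
      "\<phi> (snd (ab v)) < s v \<Longrightarrow> \<phi> (snd (ab v)) + \<delta> < s v"
      using wrap spread sep ab(1,2) [OF that] unfolding s_def by simp_all
    then show "s v \<le> t v" "t v + \<delta> < s v + 2 * pi" unfolding t_def by auto
  qed
  define R where "R v = (if v \<in> W then R' v else cw \<beta> ` {s v..t v + \<delta>})" for v
  have arc: "closed_arc (R v)" if "v \<in> V" for v
    using arcs [of v] closed_arc_cw [of "s v" "t v + \<delta>" \<beta>] st [OF that] \<delta> unfolding R_def by auto
  \<comment> \<open>A stretch lies entirely inside or entirely outside a new arc; if the interval
    wraps, the stretches at its end are met only after adding a full turn.\<close>
  have new_blob: "cw \<beta> x \<in> cw \<beta> ` {s v..t v + \<delta>} \<longleftrightarrow> v \<in> C"
    if v: "v \<in> V" and C: "C \<in> X" and x: "\<phi> C \<le> x" "x \<le> \<phi> C + \<delta>" for v C x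
  proof
    let ?a = "fst (ab v)" and ?b = "snd (ab v)"
    have far: "\<phi> C < \<phi> ?b + 2 * pi" "\<phi> ?a < \<phi> C + 2 * pi" using spread ab(1,2) [OF v] C by auto
    assume "v \<in> C"
    then consider "\<phi> ?a \<le> \<phi> C" "\<phi> C \<le> \<phi> ?b" | "\<phi> ?b < \<phi> ?a" "\<phi> ?a \<le> \<phi> C"
      | "\<phi> ?b < \<phi> ?a" "\<phi> C \<le> \<phi> ?b"
      using ab(3) [OF v C] by blast
    then have "x \<in> {s v..t v + \<delta>} \<or> x + 2 * pi \<in> {s v..t v + \<delta>}"
    proof cases
      case 1
      then show ?thesis using x by (simp add: s_def t_def)
    next
      case 2
      then show ?thesis using x far by (simp add: s_def t_def)
    next
      case 3
      then show ?thesis using x far by (simp add: s_def t_def)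
    qed
    then show "cw \<beta> x \<in> cw \<beta> ` {s v..t v + \<delta>}" by (metis cw_periodic imageI)
  next
    let ?a = "fst (ab v)" and ?b = "snd (ab v)"
    assume "cw \<beta> x \<in> cw \<beta> ` {s v..t v + \<delta>}"
    then obtain y where y: "s v \<le> y" "y \<le> t v + \<delta>" "cw \<beta> x = cw \<beta> y" by auto
    show "v \<in> C"
    proof (rule ccontr)
      assume "v \<notin> C"
      then have neg: "\<not> (\<phi> ?a \<le> \<phi> C \<and> \<phi> C \<le> \<phi> ?b)" "\<phi> ?b < \<phi> ?a \<Longrightarrow> \<phi> ?b < \<phi> C \<and> \<phi> C < \<phi> ?a"
        using ab(3) [OF v C] by auto
      have b: "\<phi> ?b + \<delta> < \<phi> C + 2 * pi" "\<phi> C + \<delta> < \<phi> ?a + 2 * pi" "\<phi> C < \<phi> ?a \<Longrightarrow> \<phi> C + \<delta> < \<phi> ?a"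
        "\<phi> ?b < \<phi> C \<Longrightarrow> \<phi> ?b + \<delta> < \<phi> C"
        using wrap sep ab(1,2) [OF v] C by auto
      \<comment> \<open>Distinct angles less than a full turn apart give distinct points; the choice
        of \<delta> ensures both.\<close>
      have "\<bar>x - y\<bar> < 2 * pi \<and> x \<noteq> y"
      proof (cases "\<phi> ?a \<le> \<phi> ?b")
        case True
        then have "y \<le> \<phi> ?b + \<delta>" "\<phi> ?a \<le> y" using y by (simp_all add: t_def s_def)
        moreover have "\<phi> C < \<phi> ?a \<or> \<phi> ?b < \<phi> C" using neg(1) by linarith
        ultimately show ?thesis using b x by linarith
      next
        case False
        then have "y \<le> \<phi> ?b + 2 * pi + \<delta>" "\<phi> ?a \<le> y" using y by (simp_all add: t_def s_def)
        moreover have "\<phi> ?b < \<phi> C" "\<phi> C < \<phi> ?a" using neg(2) False by auto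
        ultimately show ?thesis using b x by linarith
      qed
      then show False using cw_inj [OF y(3)] by blast
    qed
  qed
  have R_blob: "cw \<beta> x \<in> R v \<longleftrightarrow> v \<in> C" if "v \<in> V" "C \<in> X" "\<phi> C \<le> x" "x \<le> \<phi> C + \<delta>" for v C x
    using new_blob [OF that] blob [OF that(2-4)] unfolding R_def Reg_iff by auto
  have R_point: "cw \<beta> (\<phi> C) \<in> R v \<longleftrightarrow> v \<in> C" if "v \<in> V" "C \<in> X" for v C
    using R_blob [OF that] \<delta> by simp
  \<comment> \<open>Both ends of a new arc \<open>R v\<close> lie in stretches of cliques containing
    \<open>v\<close>. If \<open>u\<close> shares no clique with \<open>v\<close>, then
    \<open>R u\<close> avoids these stretches, so on meeting \<open>R v\<close> it is swallowed by
    it. But then \<open>v\<close> belongs to every maximal clique of \<open>u\<close>.\<close>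
  have common: "\<exists>C\<in>X. u \<in> C \<and> v \<in> C" if u: "u \<in> V" and v: "v \<in> V" "v \<notin> W" and meet: "R u \<inter> R v \<noteq> {}" for u v
  proof (rule ccontr)
    assume none: "\<not> (\<exists>C\<in>X. u \<in> C \<and> v \<in> C)"
    let ?a = "fst (ab v)" and ?b = "snd (ab v)"
    have "v \<in> ?a" "v \<in> ?b" using ab(3) [OF v(1) ab(1) [OF v(1)]] ab(3) [OF v(1) ab(2) [OF v(1)]] by auto
    then have "u \<notin> ?a" "u \<notin> ?b" using none ab(1,2) [OF v(1)] by auto
    then have a: "cw \<beta> (s v) \<notin> R u" and b: "\<And>x. \<phi> ?b \<le> x \<Longrightarrow> x \<le> \<phi> ?b + \<delta> \<Longrightarrow> cw \<beta> x \<notin> R u"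
      using R_point [OF u ab(1) [OF v(1)]] R_blob [OF u ab(2) [OF v(1)]] unfolding s_def by auto
    have b': "cw \<beta> x \<notin> R u" if "t v \<le> x" "x \<le> t v + \<delta>" for x
    proof (cases "s v \<le> \<phi> ?b")
      case True
      then show ?thesis using b that by (simp add: t_def)
    next
      case False
      then have "cw \<beta> (x - 2 * pi) \<notin> R u" using b [of "x - 2 * pi"] that by (simp add: t_def)
      then show ?thesis using cw_periodic [of \<beta> "x - 2 * pi"] by simp
    qed
    obtain \<tau> where \<tau>: "s v \<le> \<tau>" "\<tau> \<le> t v + \<delta>" "cw \<beta> \<tau> \<in> R u"
      using meet v(2) unfolding R_def [of v] by auto
    have "\<tau> < t v" using b' [of \<tau>] \<tau> by force
    moreover have "s v < \<tau>" using a \<tau> by (metis order_less_le)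
    ultimately have "R u \<subseteq> cw \<beta> ` {s v<..<t v}"
      using connected_subset_cw_interval [OF closed_arc_connected closed_arc_subset_circle, OF arc arc, OF u u a,
          of "t v" \<tau>] b' [of "t v"] \<tau>(3) st [OF v(1)] \<delta> by simp
    also have "\<dots> \<subseteq> R v" using v(2) \<delta> unfolding R_def by (auto intro!: image_mono)
    finally have sub: "R u \<subseteq> R v" .
    have "is_clique V E {u}" using u by (simp add: is_clique_def)
    then obtain M where M: "M \<in> X" "{u} \<subseteq> M" using clique_extends_to_max_clique [OF graph] by blast
    then have "cw \<beta> (\<phi> M) \<in> R u" using R_point [OF u M(1)] by blast
    then have "v \<in> M" using sub R_point [OF v(1) M(1)] by blast
    then show False using none M by blast
  qed
  have adj: "R u \<inter> R v \<noteq> {} \<longleftrightarrow> (u, v) \<in> E" if uv: "u \<in> V" "v \<in> V" "u \<noteq> v" for u v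
  proof
    assume meet: "R u \<inter> R v \<noteq> {}"
    show "(u, v) \<in> E"
    proof (cases "u \<in> W \<and> v \<in> W")
      case True
      then have "(u, v) \<in> induced_edges E W"
        using partial meet uv(3) unfolding helly_rep_def circular_arc_rep_def R_def by simp
      then show ?thesis by (simp add: induced_edges_def)
    next
      case False
      have "\<exists>C\<in>X. u \<in> C \<and> v \<in> C"
      proof (cases "v \<in> W")
        case True
        then show ?thesis using False common [OF uv(2,1)] meet by (auto simp: Int_commute)
      next
        case False
        then show ?thesis using common [OF uv(1,2)] meet by simp
      qed
      then show ?thesis using max_clique_adjacent uv(3) by metis
    qed
  next
    assume "(u, v) \<in> E"
    then have "is_clique V E {u, v}" using uv symD [OF sym] by (auto simp: is_clique_def)
    then obtain M where M: "M \<in> X" "{u, v} \<subseteq> M" using clique_extends_to_max_clique [OF graph] by blast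
    then have "cw \<beta> (\<phi> M) \<in> R u \<inter> R v" using R_point uv by simp
    then show "R u \<inter> R v \<noteq> {}" by blast
  qed
  have "\<exists>p\<in>circle. \<forall>A\<in>F. p \<in> A"
    if F: "F \<subseteq> R ` V" "\<forall>A\<in>F. \<forall>B\<in>F. A \<inter> B \<noteq> {}" for F
  proof -
    \<comment> \<open>The vertices of a pairwise meeting family form a clique; the point of any
      maximal clique above it is common to all the arcs.\<close>
    have "is_clique V E {v \<in> V. R v \<in> F}" 
      using F(2) by (auto simp: is_clique_def simp flip: adj)
    then obtain M where M: "M \<in> X" "{v \<in> V. R v \<in> F} \<subseteq> M"
      using clique_extends_to_max_clique [OF graph] by blast
    have "cw \<beta> (\<phi> M) \<in> A" if A: "A \<in> F" for A
    proof -
      obtain v where v: "v \<in> V" "A = R v" using F(1) A by blast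
      then have "v \<in> M" using M(2) A by auto
      then show ?thesis using R_point [OF v(1) M(1)] v(2) by simp
    qed
    then show ?thesis by (intro bexI [of _ "cw \<beta> (\<phi> M)"]) auto
  qed
  then have "helly_rep V E R"
    unfolding helly_rep_def circular_arc_rep_def using arc adj by simp
  moreover have "rep_extends W R' R" by (simp add: rep_extends_def R_def)
  ultimately show ?thesis by blast
qed

end

text \<open>A point \<open>p\<close> of a region can be an end of it. Then the circle is cut at a nearby interior
  point instead, from which \<open>p\<close> is reached through the small signed angle \<open>- h\<close>.\<close>

lemma (in arc_family) Reg_base_point:
  assumes "p \<in> Reg W R' C"
  obtains \<beta> h where "\<bar>h\<bar> < 2 * pi" "cw \<beta> (- h) = p"
    "\<And>x. min 0 (- h) \<le> x \<Longrightarrow> x \<le> max 0 (- h) \<Longrightarrow> cw \<beta> x \<in> Reg W R' C"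
    "\<forall>\<^sub>F x in nhds 0. cw \<beta> x \<in> Reg W R' C"
proof -
  define \<beta> where "\<beta> = Arg p"
  have p: "cw \<beta> 0 = p"
    using assms Reg_subset_circle rcis_cmod_Arg [of p] by (auto simp: \<beta>_def cw_def circle_def rcis_def subset_iff)
  have "\<exists>h. 0 < \<bar>h\<bar> \<and> \<bar>h\<bar> < 2 * pi \<and> (\<forall>x. 0 < x * sgn h \<and> x * sgn h < 2 * \<bar>h\<bar> \<longrightarrow> cw \<beta> x \<in> Reg W R' C)"
  proof (rule disjE [OF Reg_one_sided [of \<beta> 0 C, unfolded p, OF assms]], goal_cases)
    case 1
    then obtain b where b: "b > 0" "\<And>x. 0 < x \<Longrightarrow> x < b \<Longrightarrow> cw \<beta> x \<in> Reg W R' C"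
      unfolding eventually_at_right_field by blast
    \<comment> \<open>Half of \<open>b\<close> leaves equal room on both sides of the new base; the
      bound 1 keeps the angle below a full turn.\<close>
    define h where "h = min (b / 2) 1"
    have "0 < h" "h < 2 * pi" "2 * h \<le> b" using b(1) pi_gt3 by (auto simp: h_def)
    then show ?case using b by (intro exI [of _ h]) auto
  next
    case 2
    then obtain b where b: "b < 0" "\<And>x. b < x \<Longrightarrow> x < 0 \<Longrightarrow> cw \<beta> x \<in> Reg W R' C"
      unfolding eventually_at_left_field by blast
    define h where "h = max (b / 2) (- 1)"
    have "h < 0" "- h < 2 * pi" "b \<le> 2 * h" using b(1) pi_gt3 by (auto simp: h_def)
    then show ?case using b by (intro exI [of _ h]) auto
  qed
  then obtain h where h: "0 < \<bar>h\<bar>" "\<bar>h\<bar> < 2 * pi"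
    "\<And>x. 0 < x * sgn h \<Longrightarrow> x * sgn h < 2 * \<bar>h\<bar> \<Longrightarrow> cw \<beta> x \<in> Reg W R' C" by blast
  have in_Reg: "cw (\<beta> - h) x \<in> Reg W R' C" if "\<bar>x\<bar> < \<bar>h\<bar>" for x
    unfolding cw_add by (rule h(3)) (use that h(1) in \<open>auto simp: sgn_if\<close>)
  show thesis
  proof (rule that)
    show "cw (\<beta> - h) (- h) = p" unfolding cw_add using p by simp
    then show "cw (\<beta> - h) x \<in> Reg W R' C" if "min 0 (- h) \<le> x" "x \<le> max 0 (- h)" for x
      using in_Reg [of x] that assms h(1) by (cases "x = - h") (auto simp: min_def max_def split: if_splits)
    show "\<forall>\<^sub>F x in nhds 0. cw (\<beta> - h) x \<in> Reg W R' C"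
      unfolding eventually_nhds_metric using in_Reg h(1) by (intro exI [of _ "\<bar>h\<bar>"]) auto
  qed (rule h(2))
qed

section \<open>Cells of the circle opened inside the region of \<open>D\<close>\<close>

locale cut_representation = partial_representation W R' V E D
  for W :: "'a set" and R' V E D +
  fixes \<beta> :: real
  assumes near_base: "\<forall>\<^sub>F x in nhds 0. cw \<beta> x \<in> Reg W R' D"
begin

text \<open>The cells are the components of \<open>U\<close>, numbered clockwise by \<open>cell\<close>.\<close>

definition "K = {t \<in> {0<..<2 * pi}. \<exists>w\<in>W. cw \<beta> t \<in> arc_ends w}"

definition "U = {0<..<2 * pi} - K"

definition "cell t = card {k \<in> K. k < t}" for t :: real

definition "cells C = cell ` {t \<in> U. cw \<beta> t \<in> Reg W R' C}"

lemma finite_K: "finite K"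
proof (rule finite_imageD)
  show "finite (cw \<beta> ` K)"
    by (rule finite_subset [of _ "\<Union> (arc_ends ` W)"])
      (auto simp: K_def finite_W finite_arc_ends)
  show "inj_on (cw \<beta>) K"
    by (rule inj_onI, rule cw_inj) (auto simp: K_def)
qed

lemma cell_mono: "s \<le> t \<Longrightarrow> cell s \<le> cell t"
  unfolding cell_def by (intro card_mono) (auto simp: finite_K)

lemma cell_le_card: "cell t \<le> card K"
  unfolding cell_def by (intro card_mono) (auto simp: finite_K)

lemma finite_cells: "finite (cells C)"
  by (rule finite_subset [of _ "{..card K}"]) (auto simp: cells_def cell_le_card)

lemma cell_less: "cell s < cell t \<Longrightarrow> s < t"
  using cell_mono [of t s] by (meson leD le_less_linear)

lemma not_arc_end: "t \<in> U \<Longrightarrow> w \<in> W \<Longrightarrow> cw \<beta> t \<notin> arc_ends w"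
  by (auto simp: U_def K_def)

text \<open>Equal counts mean that no end lies between the two angles, so each arc contains all or
  nothing of the segment joining them.\<close>

lemma same_cell_aux:
  assumes "s \<in> U" "t \<in> U" "cell s = cell t" "s \<le> t"
  shows "cw \<beta> s \<in> Reg W R' C \<longleftrightarrow> cw \<beta> t \<in> Reg W R' C"
proof -
  have eq: "{k \<in> K. k < s} = {k \<in> K. k < t}"
    using assms finite_K unfolding cell_def by (intro card_subset_eq) auto
  have no_K: "x \<notin> K" if "s \<le> x" "x \<le> t" for x
  proof
    assume "x \<in> K"
    then have "x \<in> {k \<in> K. k < t}" using assms(2) that by (auto simp: U_def order_less_le)
    then have "x \<in> {k \<in> K. k < s}" using eq by blast
    then show False using that by simp
  qed
  have "cw \<beta> s \<in> R' w \<longleftrightarrow> cw \<beta> t \<in> R' w" if "w \<in> W" for w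
  proof (rule connected_avoiding_ends [OF that])
    show "connected (cw \<beta> ` {s..t})" by (intro connected_continuous_image continuous_on_cw) simp
    show "cw \<beta> ` {s..t} \<inter> arc_ends w = {}"
      using no_K that assms(1,2) by (fastforce simp: K_def U_def)
  qed (use assms(4) in auto)
  then show ?thesis by (simp add: Reg_iff)
qed

lemma same_cell:
  assumes "s \<in> U" "t \<in> U" "cell s = cell t"
  shows "cw \<beta> s \<in> Reg W R' C \<longleftrightarrow> cw \<beta> t \<in> Reg W R' C"
  using same_cell_aux [of s t C] same_cell_aux [of t s C] assms by linarith

lemma base_in_Reg: "cw \<beta> 0 \<in> Reg W R' D"
  using eventually_nhds_x_imp_x [OF near_base] .

text \<open>A region point at which an arc ends lies in no cell. One-sidedness moves it into an
  adjacent cell, as little as \<open>S\<close> demands.\<close>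

lemma Reg_approximation:
  assumes t: "0 < t" "t < 2 * pi" "cw \<beta> t \<in> Reg W R' C" and S: "open S" "t \<in> S"
  obtains t' where "t' \<in> U" "t' \<in> S" "cw \<beta> t' \<in> Reg W R' C"
proof -
  have "\<exists>t'. t' \<in> U \<and> t' \<in> S \<and> cw \<beta> t' \<in> Reg W R' C"
    if side: "\<forall>\<^sub>F x in at t within T. cw \<beta> x \<in> Reg W R' C" and ne: "at t within T \<noteq> bot" for T
  proof -
    have "open ({0<..<2 * pi} \<inter> S - (K - {t}))"
      using S(1) finite_K by (intro open_Diff open_Int finite_imp_closed) auto
    then have "\<forall>\<^sub>F x in at t within T. x \<in> {0<..<2 * pi} \<inter> S - (K - {t})"
      using t S(2) by (intro eventually_at_in_open' [THEN filter_leD [OF at_le, rotated]]) auto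
    moreover have "\<forall>\<^sub>F x in at t within T. x \<noteq> t" by (simp add: eventually_at_filter)
    ultimately have "\<forall>\<^sub>F x in at t within T. x \<in> U \<and> x \<in> S \<and> cw \<beta> x \<in> Reg W R' C"
      using side by eventually_elim (auto simp: U_def)
    then show ?thesis using eventually_happens ne by blast
  qed
  then show thesis
    using Reg_one_sided [OF t(3)] that trivial_limit_at_right_real trivial_limit_at_left_real by metis
qed

text \<open>The base point is interior to the region of \<open>D\<close>, so that region is met
  right after angle 0 and right before 2 * pi. A clique sharing it can therefore neither follow nor
  precede another one cell by cell.\<close>

lemma extreme_cells:
  assumes "Reg W R' C = Reg W R' D"
  shows "0 \<in> cells C" "card K \<in> cells C"
proof -
  obtain r where r: "r > 0" "\<And>x. \<bar>x\<bar> < r \<Longrightarrow> cw \<beta> x \<in> Reg W R' C"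
    using near_base unfolding eventually_nhds_metric assms by auto
  have "\<forall>\<^sub>F x in at_right 0. x \<in> {0<..<2 * pi}" "\<forall>\<^sub>F x in at_right 0. x \<in> {0<..<r}"
    by (rule eventually_at_right_real; use r(1) in simp)+
  moreover have "\<forall>\<^sub>F x in at_right 0. \<forall>k\<in>K. x < k"
  proof (intro eventually_ball_finite finite_K ballI)
    fix k assume "k \<in> K"
    then have "\<forall>\<^sub>F x in at_right 0. x \<in> {0<..<k}" by (intro eventually_at_right_real) (simp add: K_def)
    then show "\<forall>\<^sub>F x in at_right 0. x < k" by eventually_elim simp
  qed
  ultimately have "\<forall>\<^sub>F x in at_right 0. x \<in> U \<and> cw \<beta> x \<in> Reg W R' C \<and> cell x = 0"
    by eventually_elim (use r(2) in \<open>force simp: U_def cell_def finite_K\<close>)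
  then obtain x where "x \<in> U" "cw \<beta> x \<in> Reg W R' C" "cell x = 0"
    using eventually_happens trivial_limit_at_right_real by blast
  then show "0 \<in> cells C" unfolding cells_def by force
  have "\<forall>\<^sub>F x in at_left (2 * pi). x \<in> {0<..<2 * pi}" "\<forall>\<^sub>F x in at_left (2 * pi). x \<in> {2 * pi - r<..<2 * pi}"
    by (rule eventually_at_left_real; use r(1) in simp)+
  moreover have "\<forall>\<^sub>F x in at_left (2 * pi). \<forall>k\<in>K. k < x"
  proof (intro eventually_ball_finite finite_K ballI)
    fix k assume "k \<in> K"
    then have "\<forall>\<^sub>F x in at_left (2 * pi). x \<in> {k<..<2 * pi}" by (intro eventually_at_left_real) (simp add: K_def)
    then show "\<forall>\<^sub>F x in at_left (2 * pi). k < x" by eventually_elim simp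
  qed
  ultimately have "\<forall>\<^sub>F x in at_left (2 * pi). x \<in> U \<and> cw \<beta> x \<in> Reg W R' C \<and> cell x = card K"
  proof eventually_elim
    case (elim x)
    then have "{k \<in> K. k < x} = K" "x \<in> U" by (auto simp: U_def)
    moreover have "cw \<beta> x \<in> Reg W R' C" using r(2) [of "x - 2 * pi"] cw_periodic [of \<beta> "x - 2 * pi"] elim by simp
    ultimately show ?case by (simp add: cell_def)
  qed
  then obtain x where "x \<in> U" "cw \<beta> x \<in> Reg W R' C" "cell x = card K"
    using eventually_happens trivial_limit_at_left_real by blast
  then show "card K \<in> cells C" unfolding cells_def by force
qed

text \<open>The case split disposes of angle 0, which \<open>Reg_approximation\<close> does not
  cover: only the region of \<open>D\<close> contains the base point.\<close>

lemma cells_nonempty: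
  assumes "C \<in> X"
  shows "cells C \<noteq> {}"
proof (cases "Reg W R' C = Reg W R' D")
  case True
  then show ?thesis using extreme_cells by blast
next
  case False
  obtain p where p: "p \<in> Reg W R' C" using Reg_nonempty [OF assms] by blast
  then obtain t where t: "0 \<le> t" "t < 0 + 2 * pi" "p = cw \<beta> t"
    using circle_cwE [of p 0 \<beta>] Reg_subset_circle by blast
  then have "t \<noteq> 0" using False Reg_eq_if_meet [OF p] base_in_Reg by auto
  then obtain t' where "t' \<in> U" "cw \<beta> t' \<in> Reg W R' C"
    using Reg_approximation [of t C UNIV] t p by auto
  then show ?thesis by (auto simp: cells_def)
qed

text \<open>The gap around \<open>s\<close> and \<open>t\<close> is confined between the points of
  \<open>C\<close> at \<open>y\<close> and \<open>z\<close>, so it misses the base point. As the gap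
  contains a region wholly or not at all, it misses the region of \<open>D\<close>.\<close>

lemma gap_separates:
  assumes order: "0 < y" "y < s" "s \<le> t" "t < z" "z < 2 * pi"
    and C: "cw \<beta> y \<in> Reg W R' C" "cw \<beta> z \<in> Reg W R' C"
    and C\<^sub>1: "C\<^sub>1 \<in> X" "cw \<beta> s \<in> Reg W R' C\<^sub>1" and C\<^sub>2: "C\<^sub>2 \<in> X" "cw \<beta> t \<in> Reg W R' C\<^sub>2"
    and free: "\<And>x. s \<le> x \<Longrightarrow> x \<le> t \<Longrightarrow> cw \<beta> x \<notin> Reg W R' C"
  obtains J where "J \<in> gaps W R' C" "C\<^sub>1 \<in> gap_cliques V E W R' J" "C\<^sub>2 \<in> gap_cliques V E W R' J"
    "C \<notin> gap_cliques V E W R' J" "D \<notin> gap_cliques V E W R' J"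
proof -
  obtain J where J: "J \<in> gaps W R' C" "cw \<beta> ` {s..t} \<subseteq> J"
    using gap_contains_interval [OF order(3) free] by blast
  then have st: "cw \<beta> s \<in> J" "cw \<beta> t \<in> J" using order(3) by auto
  have "D \<notin> gap_cliques V E W R' J"
  proof
    assume "D \<in> gap_cliques V E W R' J"
    then have "cw \<beta> 0 \<in> J"
      using Reg_within_gap [OF J(1) _ _ base_in_Reg] by (auto simp: gap_cliques_def)
    moreover have "J \<subseteq> cw \<beta> ` {y<..<z}"
      using connected_subset_cw_interval [OF gap_connected gap_subset_circle, OF J(1) J(1), of \<beta> y z s]
        gap_disjoint_Reg [OF J(1)] C order st by auto
    ultimately have "cw \<beta> 0 \<in> cw \<beta> ` {y<..<z}" by blast
    then obtain x where "y < x" "x < z" "cw \<beta> 0 = cw \<beta> x" by auto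
    then show False using cw_inj [of \<beta> 0 x] order by simp
  qed
  moreover have "C \<notin> gap_cliques V E W R' J"
    using gap_disjoint_Reg [OF J(1)] by (auto simp: gap_cliques_def)
  moreover have "C\<^sub>1 \<in> gap_cliques V E W R' J" "C\<^sub>2 \<in> gap_cliques V E W R' J"
    using C\<^sub>1 C\<^sub>2 st by (auto simp: gap_cliques_def)
  ultimately show thesis using that J(1) by blast
qed

text \<open>Cells see only angles in \<open>U\<close>, counted from the base, while
  \<open>clique_prec\<close> concerns all region points, counted from the given point of
  \<open>D\<close>. Approximation bridges the first difference, the shift \<open>h\<close> the
  second.\<close>

lemma prec_if_cells_less:
  assumes C: "C \<in> X" "C' \<in> X" and less: "\<And>x y. x \<in> cells C \<Longrightarrow> y \<in> cells C' \<Longrightarrow> x < y"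
    and h: "\<bar>h\<bar> < 2 * pi" "\<And>x. min 0 (- h) \<le> x \<Longrightarrow> x \<le> max 0 (- h) \<Longrightarrow> cw \<beta> x \<in> Reg W R' D"
  shows "(C, C') \<in> clique_prec V E W R' D (cw \<beta> (- h))"
proof -
  have ne: "cells C \<noteq> {}" "cells C' \<noteq> {}" using cells_nonempty C by auto
  have "Reg W R' C' \<noteq> Reg W R' D" using extreme_cells(1) [of C'] less ne(1) by fastforce
  moreover have "Reg W R' C \<noteq> Reg W R' D"
  proof
    assume "Reg W R' C = Reg W R' D"
    then have "card K \<in> cells C" by (rule extreme_cells(2))
    moreover obtain y where "y \<in> cells C'" "y \<le> card K" using ne(2) cell_le_card by (auto simp: cells_def)
    ultimately show False using less by fastforce
  qed
  moreover have "clockwise_less (cw \<beta> (- h)) p q" if p: "p \<in> Reg W R' C" and q: "q \<in> Reg W R' C'" for p q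
  proof -
    \<comment> \<open>Points outside the region of \<open>D\<close> avoid the stretch between the
      two base points, so their angle is positive and below a full turn from either.\<close>
    have angle: "\<exists>t. 0 < t \<and> t < 2 * pi \<and> 0 < t + h \<and> t + h < 2 * pi \<and> x = cw \<beta> t"
      if x: "x \<in> Reg W R' B" and B: "Reg W R' B \<noteq> Reg W R' D" for x B
    proof -
      have xD: "x \<notin> Reg W R' D" using Reg_eq_if_meet [OF x] B by blast
      obtain t where t: "0 \<le> t" "t < 0 + 2 * pi" "x = cw \<beta> t"
        using circle_cwE [of x 0 \<beta>] x Reg_subset_circle by blast
      have "t \<noteq> 0" using t(3) xD base_in_Reg by auto
      moreover have "\<not> (min 0 (- h) \<le> t \<and> t \<le> max 0 (- h))" using h(2) [of t] t(3) xD by auto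
      then have "0 < t + h" using t(1) by (auto simp: min_def max_def split: if_splits)
      moreover have "\<not> (min 0 (- h) \<le> t - 2 * pi \<and> t - 2 * pi \<le> max 0 (- h))"
        using h(2) [of "t - 2 * pi"] cw_periodic [of \<beta> "t - 2 * pi"] t(3) xD by auto
      then have "t + h < 2 * pi" using t(2) by (auto simp: min_def max_def split: if_splits)
      ultimately show ?thesis using t by (intro exI [of _ t]) auto
    qed
    obtain s where s: "0 < s" "s < 2 * pi" "0 < s + h" "s + h < 2 * pi" "p = cw \<beta> s"
      using angle [OF p \<open>Reg W R' C \<noteq> Reg W R' D\<close>] by blast
    obtain t where t: "0 < t" "t < 2 * pi" "0 < t + h" "t + h < 2 * pi" "q = cw \<beta> t"
      using angle [OF q \<open>Reg W R' C' \<noteq> Reg W R' D\<close>] by blast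
    have "s < t"
    proof (rule ccontr)
      assume "\<not> s < t"
      then consider "s = t" | "t < s" by linarith
      then show False
      proof cases
        case 1
        then have "Reg W R' C = Reg W R' C'" using Reg_eq_if_meet [OF p] q s(5) t(5) by simp
        then have "cells C = cells C'" by (simp add: cells_def)
        then show False using less ne by blast
      next
        case 2
        \<comment> \<open>The midpoint keeps the approximations in the order of \<open>t\<close> and
          \<open>s\<close>, against the order of their cells.\<close>
        obtain s' where s': "s' \<in> U" "s' \<in> {(s + t) / 2<..}" "cw \<beta> s' \<in> Reg W R' C"
          by (rule Reg_approximation [of s C "{(s + t) / 2<..}"]) (use s p 2 in auto)
        obtain t' where t': "t' \<in> U" "t' \<in> {..<(s + t) / 2}" "cw \<beta> t' \<in> Reg W R' C'"
          by (rule Reg_approximation [of t C' "{..<(s + t) / 2}"]) (use t q 2 in auto)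
        have "cell s' < cell t'" using less s' t' by (auto simp: cells_def)
        then show False using cell_less s'(2) t'(2) by fastforce
      qed
    qed
    then show ?thesis
      using clockwise_less_cw [of "s + h" "t + h" "\<beta> + h"] s t
        cw_add [of "\<beta> + h" h "- h"] cw_add [of "\<beta> + h" h s] cw_add [of "\<beta> + h" h t] by simp
  qed
  ultimately show ?thesis using C unfolding clique_prec_def by auto
qed

lemma points_if_ordering:
  assumes L: "linear_extension X (clique_prec V E W R' D (cw \<beta> (- h))) L"
    and h: "\<bar>h\<bar> < 2 * pi" "\<And>x. min 0 (- h) \<le> x \<Longrightarrow> x \<le> max 0 (- h) \<Longrightarrow> cw \<beta> x \<in> Reg W R' D"
    and con: "\<And>C J. C \<in> X \<Longrightarrow> J \<in> gaps W R' C \<Longrightarrow> consecutive X (cyclic_order L) (gap_cliques V E W R' J)"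
  obtains \<phi> :: "'a set \<Rightarrow> real"
  where "inj_on \<phi> X" "L = {(C, C'). C \<in> X \<and> C' \<in> X \<and> \<phi> C < \<phi> C'}"
    "\<And>C. C \<in> X \<Longrightarrow> 0 < \<phi> C \<and> \<phi> C < 2 * pi"
    "\<And>C. C \<in> X \<Longrightarrow> \<forall>\<^sub>F x in nhds (\<phi> C). cw \<beta> x \<in> Reg W R' C"
proof -
  have L': "L \<subseteq> X \<times> X" "strict_linear_order_on X L" "clique_prec V E W R' D (cw \<beta> (- h)) \<subseteq> L"
    using L by (auto simp: linear_extension_def)
  obtain r :: "'a set \<Rightarrow> nat" where r: "bij_betw r X {..<card X}"
    "L = {(C, C'). C \<in> X \<and> C' \<in> X \<and> r C < r C'}"
    using strict_linear_order_enumeration [OF finite_X L'(2,1)] .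
  have r_inj: "inj_on r X" using r(1) by (simp add: bij_betw_def)
  define g where "g = the_inv_into X r"
  have g: "g i \<in> X" "r (g i) = i" if "i < card X" for i
    using that r(1) unfolding g_def bij_betw_def
    by (auto intro: the_inv_into_into f_the_inv_into_f)
  have gr: "g (r C) = C" "r C < card X" if "C \<in> X" for C
    using that r(1) unfolding g_def bij_betw_def by (auto simp: the_inv_into_f_f)
  have D_first: "r D \<le> r C" if "C \<in> X" for C
  proof (cases "C = D")
    case False
    then have "(D, C) \<in> clique_prec V E W R' D (cw \<beta> (- h))" using that D_max by (simp add: clique_prec_def)
    then show ?thesis using L'(3) r(2) by auto
  qed simp
  have "0 < card X" using finite_X D_max card_gt_0_iff by blast
  then have "r D = 0" using D_first [OF g(1), of 0] g(2) [of 0] by simp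
  then have g0: "g 0 = D" using gr(1) [OF D_max] by simp
  have "\<exists>c. (\<forall>i<card X. c i \<in> cells (g i)) \<and> (\<forall>i j. i \<le> j \<longrightarrow> j < card X \<longrightarrow> c i \<le> c j)"
  proof (rule monotone_selection)
    show "finite (cells (g i)) \<and> cells (g i) \<noteq> {}" if "i < card X" for i
      using finite_cells cells_nonempty g(1) [OF that] by blast
    show "0 \<in> cells (g 0)" unfolding g0 by (rule extreme_cells) simp
  next
    fix i j assume ij: "0 < i" "i < j" "j < card X"
    show "\<exists>x\<in>cells (g i). \<exists>y\<in>cells (g j). x \<le> y"
    proof (rule ccontr)
      assume "\<not> ?thesis"
      then have "y < x" if "y \<in> cells (g j)" "x \<in> cells (g i)" for x y using that by (meson not_le)
      then have "(g j, g i) \<in> L"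
        using prec_if_cells_less [of "g j" "g i" h] g(1) [of i] g(1) [of j] ij h L'(3) by auto
      then show False using r(2) g(2) [of i] g(2) [of j] ij by simp
    qed
  next
    fix k j i a x y z
    assume *: "k < j" "j < i" "i < card X" "a \<in> cells (g k)" "x \<in> cells (g i)"
      "y \<in> cells (g j)" "z \<in> cells (g j)" "y < a" "a \<le> x" "x < z"
    obtain s where s: "s \<in> U" "cw \<beta> s \<in> Reg W R' (g k)" "cell s = a" using *(4) by (auto simp: cells_def)
    obtain t\<^sub>0 where t\<^sub>0: "t\<^sub>0 \<in> U" "cw \<beta> t\<^sub>0 \<in> Reg W R' (g i)" "cell t\<^sub>0 = x" using *(5) by (auto simp: cells_def)
    obtain u where u: "u \<in> U" "cw \<beta> u \<in> Reg W R' (g j)" "cell u = y" using *(6) by (auto simp: cells_def)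
    obtain v where v: "v \<in> U" "cw \<beta> v \<in> Reg W R' (g j)" "cell v = z" using *(7) by (auto simp: cells_def)
    \<comment> \<open>If both cliques use the same cell, the point at \<open>s\<close> lies in both
      regions; choosing it again guarantees s \<le> t.\<close>
    define t where "t = (if a = x then s else t\<^sub>0)"
    have t: "t \<in> U" "cw \<beta> t \<in> Reg W R' (g i)" "cell t = x" "s \<le> t"
      using s t\<^sub>0 same_cell [OF s(1) t\<^sub>0(1), of "g i"] cell_less [of s t\<^sub>0] *(9) unfolding t_def by auto
    have range: "0 < u" "u < s" "t < v" "v < 2 * pi"
      using u v s t cell_less *(8,10) by (auto simp: U_def)
    show "\<exists>m\<in>cells (g j). a \<le> m \<and> m \<le> x"
    proof (rule ccontr)
      assume none: "\<not> ?thesis"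
      have not_U: "cw \<beta> m \<notin> Reg W R' (g j)" if "m \<in> U" "s \<le> m" "m \<le> t" for m
        using none that cell_mono [of s m] cell_mono [of m t] s(3) t(3) by (auto simp: cells_def)
      \<comment> \<open>A region point strictly between \<open>s\<close> and \<open>t\<close> at an
        arc end could be moved into \<open>U\<close> without leaving the interval.\<close>
      have "cw \<beta> m \<notin> Reg W R' (g j)" if m: "s \<le> m" "m \<le> t" for m
      proof (cases "m = s \<or> m = t")
        case True
        then show ?thesis using not_U m s(1) t(1) by blast
      next
        case False
        show ?thesis
        proof
          assume "cw \<beta> m \<in> Reg W R' (g j)"
          then obtain m' where "m' \<in> U" "m' \<in> {s<..<t}" "cw \<beta> m' \<in> Reg W R' (g j)"
            by (rule Reg_approximation [of m "g j" "{s<..<t}", rotated 2]) (use m False range t in auto)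
          then show False using not_U by auto
        qed
      qed
      then obtain J where J: "J \<in> gaps W R' (g j)" "g k \<in> gap_cliques V E W R' J" "g i \<in> gap_cliques V E W R' J"
        "g j \<notin> gap_cliques V E W R' J" "D \<notin> gap_cliques V E W R' J"
        using gap_separates [of u s t v "g j" "g k" "g i"] range t(4) u(2) v(2) s(2) t(2)
          g(1) [of i] g(1) [of j] g(1) [of k] * by auto
      have sub: "gap_cliques V E W R' J \<subseteq> X" by (auto simp: gap_cliques_def)
      have "k \<noteq> 0" using J(2,5) g0 by metis
      \<comment> \<open>In the given order \<open>D\<close>, \<open>g k\<close>, \<open>g j\<close>,
        \<open>g i\<close> alternate between the outside and the inside of
        \<open>gap_cliques V E W R' J\<close>.\<close>
      show False
        by (rule consecutive_no_alternation [OF r_inj r(2) sub con [OF _ J(1)] J(2,3), of D "g j"])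
          (use J(4,5) g D_max * \<open>r D = 0\<close> \<open>k \<noteq> 0\<close> in auto)
    qed
  qed
  then obtain c where c: "\<And>i. i < card X \<Longrightarrow> c i \<in> cells (g i)" "\<And>i j. i \<le> j \<Longrightarrow> j < card X \<Longrightarrow> c i \<le> c j"
    by blast
  \<comment> \<open>The representative depends on the cell number only. Cliques sharing a cell get
    the same angle, so monotonicity survives ties.\<close>
  define \<theta> where "\<theta> C = (SOME t. t \<in> U \<and> cell t = c (r C))" for C
  have \<theta>: "\<theta> C \<in> U" "cell (\<theta> C) = c (r C)" "cw \<beta> (\<theta> C) \<in> Reg W R' C" if C: "C \<in> X" for C
  proof -
    obtain t where t: "t \<in> U" "cell t = c (r C)" "cw \<beta> t \<in> Reg W R' C"
      using c(1) [OF gr(2) [OF C]] unfolding gr(1) [OF C] by (auto simp: cells_def)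
    then show "\<theta> C \<in> U" "cell (\<theta> C) = c (r C)"
      unfolding \<theta>_def by (metis (mono_tags, lifting) someI_ex)+
    then show "cw \<beta> (\<theta> C) \<in> Reg W R' C" using same_cell [OF t(1)] t by simp
  qed
  have \<theta>_mono: "\<theta> C \<le> \<theta> C'" if "C \<in> X" "C' \<in> X" "r C \<le> r C'" for C C'
  proof (cases "c (r C) = c (r C')")
    case True
    then show ?thesis by (simp add: \<theta>_def)
  next
    case False
    then have "c (r C) < c (r C')" using c(2) [OF that(3) gr(2) [OF that(2)]] by simp
    then show ?thesis using cell_less [of "\<theta> C" "\<theta> C'"] \<theta>(2) that by simp
  qed
  \<comment> \<open>Adding a small multiple of the rank breaks the ties in the order of
    \<open>L\<close>; interiority is an open condition and survives.\<close>
  have "\<forall>\<^sub>F \<delta> in at_right 0. \<forall>C\<in>X. \<theta> C + \<delta> * real (r C) \<in> {0<..<2 * pi} \<and>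
      (\<forall>\<^sub>F x in nhds (\<theta> C + \<delta> * real (r C)). cw \<beta> x \<in> Reg W R' C)"
  proof (intro eventually_ball_finite finite_X ballI)
    fix C assume C: "C \<in> X"
    have "\<forall>\<^sub>F x in nhds (\<theta> C). cw \<beta> x \<in> Reg W R' C"
      by (rule Reg_interior [OF \<theta>(3) [OF C]]) (rule not_arc_end [OF \<theta>(1) [OF C]])
    then have "\<forall>\<^sub>F y in nhds (\<theta> C). \<forall>\<^sub>F x in nhds y. cw \<beta> x \<in> Reg W R' C"
      by (simp add: eventually_eventually)
    moreover have "\<forall>\<^sub>F y in nhds (\<theta> C). y \<in> {0<..<2 * pi}"
      using \<theta>(1) [OF C] by (intro eventually_nhds_in_open) (auto simp: U_def)
    ultimately have ev: "\<forall>\<^sub>F y in nhds (\<theta> C). y \<in> {0<..<2 * pi} \<and> (\<forall>\<^sub>F x in nhds y. cw \<beta> x \<in> Reg W R' C)"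
      by eventually_elim blast
    have "((\<lambda>\<delta>. \<theta> C + \<delta> * real (r C)) \<longlongrightarrow> \<theta> C + 0 * real (r C)) (at_right 0)"
      by (intro tendsto_intros)
    then show "\<forall>\<^sub>F \<delta> in at_right 0. \<theta> C + \<delta> * real (r C) \<in> {0<..<2 * pi} \<and>
      (\<forall>\<^sub>F x in nhds (\<theta> C + \<delta> * real (r C)). cw \<beta> x \<in> Reg W R' C)"
      using eventually_compose_filterlim [OF ev] by simp
  qed
  then have "\<forall>\<^sub>F \<delta> in at_right 0. 0 < \<delta> \<and> (\<forall>C\<in>X. \<theta> C + \<delta> * real (r C) \<in> {0<..<2 * pi} \<and>
      (\<forall>\<^sub>F x in nhds (\<theta> C + \<delta> * real (r C)). cw \<beta> x \<in> Reg W R' C))"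
    by (rule eventually_conj [OF eventually_at_right_less])
  from eventually_happens [OF this] obtain \<delta> :: real where \<delta>: "0 < \<delta>"
    "\<And>C. C \<in> X \<Longrightarrow> \<theta> C + \<delta> * real (r C) \<in> {0<..<2 * pi}"
    "\<And>C. C \<in> X \<Longrightarrow> \<forall>\<^sub>F x in nhds (\<theta> C + \<delta> * real (r C)). cw \<beta> x \<in> Reg W R' C"
    by auto
  define \<phi> where "\<phi> C = \<theta> C + \<delta> * real (r C)" for C
  have less: "\<phi> C < \<phi> C'" if "C \<in> X" "C' \<in> X" "r C < r C'" for C C'
    using \<theta>_mono [of C C'] that \<delta>(1) unfolding \<phi>_def by (intro add_le_less_mono) auto
  have iff: "\<phi> C < \<phi> C' \<longleftrightarrow> r C < r C'" if "C \<in> X" "C' \<in> X" for C C'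
  proof
    assume "\<phi> C < \<phi> C'"
    then show "r C < r C'"
      using less [OF that(2,1)] inj_onD [OF r_inj _ that] by (metis less_asym less_irrefl linorder_neqE_nat)
  qed (rule less [OF that])
  show thesis
  proof (rule that)
    show "inj_on \<phi> X"
      using iff inj_onD [OF r_inj] by (intro inj_onI) (metis less_irrefl linorder_neqE_nat)
    show "L = {(C, C'). C \<in> X \<and> C' \<in> X \<and> \<phi> C < \<phi> C'}" using r(2) iff by auto
    show "0 < \<phi> C \<and> \<phi> C < 2 * pi" if "C \<in> X" for C using \<delta>(2) [OF that] by (simp add: \<phi>_def)
    show "\<forall>\<^sub>F x in nhds (\<phi> C). cw \<beta> x \<in> Reg W R' C" if "C \<in> X" for C
      using \<delta>(3) [OF that] by (simp add: \<phi>_def)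
  qed
qed

end

theorem theorem8:
  fixes V W :: "'a set" and E :: "('a \<times> 'a) set" and R' :: "'a \<Rightarrow> complex set" and D :: "'a set"
  assumes "simple_graph V E"
    and "partial_helly_rep V E W R'"
    and "distinct_endpoints W R'"
    and "\<forall>C\<in>max_cliques V E. Reg W R' C \<noteq> {}"
    and "D \<in> max_cliques V E"
  shows "(\<exists>R. helly_rep V E R \<and> rep_extends W R' R) \<longleftrightarrow>
    (\<exists>pD\<in>Reg W R' D. \<exists>L. linear_extension (max_cliques V E) (clique_prec V E W R' D pD) L \<and>
       (\<forall>v\<in>V. consecutive (max_cliques V E) (cyclic_order L) (vertex_cliques V E v)) \<and>
       (\<forall>C\<in>max_cliques V E. \<forall>J\<in>gaps W R' C.
          consecutive (max_cliques V E) (cyclic_order L) (gap_cliques V E W R' J)))"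
proof -
  have arcs: "W \<subseteq> V" "helly_rep W (induced_edges E W) R'" "finite W"
    using assms(1,2) finite_subset by (auto simp: partial_helly_rep_def simple_graph_def)
  interpret partial_representation W R' V E D
    by unfold_locales
      (use assms arcs in \<open>auto simp: helly_rep_def circular_arc_rep_def\<close>)
  show ?thesis
  proof
    assume "\<exists>R. helly_rep V E R \<and> rep_extends W R' R"
    then obtain R where "helly_rep V E R" "rep_extends W R' R" by blast
    then show "\<exists>pD\<in>Reg W R' D. \<exists>L. linear_extension X (clique_prec V E W R' D pD) L \<and>
       (\<forall>v\<in>V. consecutive X (cyclic_order L) (vertex_cliques V E v)) \<and>
       (\<forall>C\<in>X. \<forall>J\<in>gaps W R' C. consecutive X (cyclic_order L) (gap_cliques V E W R' J))"
      by (rule ordering_if_extension)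
  next
    assume "\<exists>pD\<in>Reg W R' D. \<exists>L. linear_extension X (clique_prec V E W R' D pD) L \<and>
       (\<forall>v\<in>V. consecutive X (cyclic_order L) (vertex_cliques V E v)) \<and>
       (\<forall>C\<in>X. \<forall>J\<in>gaps W R' C. consecutive X (cyclic_order L) (gap_cliques V E W R' J))"
    then obtain pD L where pD: "pD \<in> Reg W R' D"
      and L: "linear_extension X (clique_prec V E W R' D pD) L"
      and con_vertex: "\<And>v. v \<in> V \<Longrightarrow> consecutive X (cyclic_order L) (vertex_cliques V E v)"
      and con_gap: "\<And>C J. C \<in> X \<Longrightarrow> J \<in> gaps W R' C \<Longrightarrow>
        consecutive X (cyclic_order L) (gap_cliques V E W R' J)"
      by auto
    \<comment> \<open>The order refers to \<open>pD\<close>, but the circle is opened at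
      \<open>cw \<beta> 0\<close>; \<open>h\<close> records the displacement.\<close>
    obtain h \<beta> where h: "\<bar>h\<bar> < 2 * pi" "cw \<beta> (- h) = pD"
      "\<And>x. min 0 (- h) \<le> x \<Longrightarrow> x \<le> max 0 (- h) \<Longrightarrow> cw \<beta> x \<in> Reg W R' D"
      "\<forall>\<^sub>F x in nhds 0. cw \<beta> x \<in> Reg W R' D"
      by (rule Reg_base_point [OF pD]) (rule that)
    interpret cut_representation W R' V E D \<beta>
      by unfold_locales (rule h(4))
    show "\<exists>R. helly_rep V E R \<and> rep_extends W R' R"
    proof (rule points_if_ordering [OF L [folded h(2)] h(1)])
      fix \<phi> :: "'a set \<Rightarrow> real"
      assume \<phi>: "inj_on \<phi> X" "L = {(C, C'). C \<in> X \<and> C' \<in> X \<and> \<phi> C < \<phi> C'}"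
        "\<And>C. C \<in> X \<Longrightarrow> 0 < \<phi> C \<and> \<phi> C < 2 * pi"
        "\<And>C. C \<in> X \<Longrightarrow> \<forall>\<^sub>F x in nhds (\<phi> C). cw \<beta> x \<in> Reg W R' C"
      have "\<phi> C < \<phi> C' + 2 * pi" if "C \<in> X" "C' \<in> X" for C C'
        using \<phi>(3) [OF that(1)] \<phi>(3) [OF that(2)] by linarith
      then show "\<exists>R. helly_rep V E R \<and> rep_extends W R' R"
        by (rule extension_if_points [OF \<phi>(1,2) _ \<phi>(4) con_vertex])
    qed (rule h(3) con_gap; assumption)+
  qed
qed

end
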